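(* Let $V(z)=z^m+\dots\in\mathbb{Z}[z]$ be monic of degree $m\ge1$, let $L=\{z\in\mathbb{C}:|V(z)|=1\}$ and $E=\{z\in\mathbb{C}:|V(z)|\le1\}$, and let $\mu$ be the measure on $L$ given by $d\mu(z)=\frac{|V'(z)|}{2\pi m}|dz|$, with $M_L(P)=\exp\left(\int\log|P|\,d\mu\right)$. Then $M_L(P)\ge1$ for every $P\in\mathbb{Z}[z]$, $P\not\equiv0$, and equality holds if and only if $P$ has leading coefficient $\pm1$ and all roots of $P$ lie in $E$. More precisely, for a monic irreducible $P\in\mathbb{Z}[z]$ we have $M_L(P)=1$ if and only if either $P\mid V$ or $P\mid\Phi\circ V$ for some cyclotomic polynomial $\Phi$. Hence if $\alpha$ is an algebraic integer which together with all of its conjugates lies in $E$, then: (i) if $\alpha$ lies in the interior $E^\circ$ of $E$, then $\alpha$ is a root of $V$; (ii) if $\alpha\in L$, then $\alpha$ is a root of $\Phi\circ V$ for some cyclotomic polynomial $\Phi$.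
   Context: The measure $\mu$ is the equilibrium measure of the lemniscate $L$ (a positive unit measure on $L$), and $M_L(P)$ is the generalized Mahler measure of $P$. A cyclotomic polynomial is the minimal polynomial over $\mathbb{Q}$ of a root of unity. *)

theory Defs
  imports "HOL-Analysis.Analysis" "HOL-Computational_Algebra.Polynomial_Factorial"
begin

section \<open>Arc length\<close>

text \<open>
  Arc length \<open>|dz|\<close> on a plane set is one-dimensional Hausdorff measure, normalised by the
  diameter so that it agrees with the length of rectifiable Jordan arcs. Boundedness of the
  covering sets is required since \<^const>\<open>diameter\<close> is a junk value on unbounded sets.
\<close>

definition hausdorff1_premeasure :: "real \<Rightarrow> 'a::metric_space set \<Rightarrow> ennreal" where
  "hausdorff1_premeasure \<delta> A =
     (INF U \<in> {U :: nat \<Rightarrow> 'a set. A \<subseteq> (\<Union>i. U i) \<and> (\<forall>i. bounded (U i) \<and> diameter (U i) \<le> \<delta>)}.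
        \<Sum>i. ennreal (diameter (U i)))"

definition hausdorff1_outer :: "'a::metric_space set \<Rightarrow> ennreal" where
  "hausdorff1_outer A = (SUP \<delta>\<in>{0<..}. hausdorff1_premeasure \<delta> A)"

definition arc_length :: "complex measure" where
  "arc_length = measure_of UNIV (sets borel) hausdorff1_outer"


section \<open>Lemniscates and the generalized Mahler measure\<close>

abbreviation cpoly :: "int poly \<Rightarrow> complex poly" where
  "cpoly p \<equiv> map_poly of_int p"

definition lemniscate :: "int poly \<Rightarrow> complex set" where
  "lemniscate V = {z. cmod (poly (cpoly V) z) = 1}"

definition filled_lemniscate :: "int poly \<Rightarrow> complex set" where
  "filled_lemniscate V = {z. cmod (poly (cpoly V) z) \<le> 1}"

definition lemniscate_measure :: "int poly \<Rightarrow> complex measure" where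
  "lemniscate_measure V =
     density (restrict_space arc_length (lemniscate V))
       (\<lambda>z. ennreal (cmod (poly (pderiv (cpoly V)) z) / (2 * pi * real (degree V))))"

text \<open>
  On the finitely many zeros of \<open>P\<close> the integrand is \<open>ln 0 = 0\<close> instead of \<open>-\<infinity>\<close>;
  for \<open>P \<noteq> 0\<close> this affects a null set only.
\<close>

definition mahler_measure :: "int poly \<Rightarrow> int poly \<Rightarrow> real" where
  "mahler_measure V P = exp (LINT z|lemniscate_measure V. ln (cmod (poly (cpoly P) z)))"


section \<open>Minimal polynomials, conjugates and cyclotomic polynomials\<close>

definition is_min_poly :: "complex \<Rightarrow> rat poly \<Rightarrow> bool" where
  "is_min_poly x p \<longleftrightarrow>
     lead_coeff p = 1 \<and> poly (map_poly of_rat p) x = 0 \<and>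
     (\<forall>q. q \<noteq> 0 \<and> poly (map_poly of_rat q) x = 0 \<longrightarrow> degree p \<le> degree q)"

definition conjugates :: "complex \<Rightarrow> complex set" where
  "conjugates x = {y. \<exists>p. is_min_poly x p \<and> poly (map_poly of_rat p) y = 0}"

text \<open>
  Roots of unity are algebraic integers, so their minimal polynomials over the rationals have
  integer coefficients and no cyclotomic polynomial is lost by typing them as integer polynomials.
\<close>

definition cyclotomic :: "int poly \<Rightarrow> bool" where
  "cyclotomic \<Phi> \<longleftrightarrow> (\<exists>\<zeta> n. n > 0 \<and> \<zeta> ^ n = 1 \<and> is_min_poly \<zeta> (map_poly of_int \<Phi>))"

end

theory Submission
  imports Defs "HOL-Complex_Analysis.Complex_Analysis"
    "HOL-Computational_Algebra.Fundamental_Theorem_Algebra"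
begin

text \<open>
  The map \<open>V\<close> covers the unit circle \<open>m\<close> times by the lemniscate and stretches arc length by \<open>|V'|\<close>,
  so integrating \<open>f\<close> against the lemniscate measure amounts to averaging the sum of \<open>f\<close> over the
  fibre of \<open>e\<^sup>i\<^sup>t\<close> and dividing by \<open>m\<close>. For \<open>f = ln |P|\<close> with \<open>P = a \<Prod> (z - \<alpha>)\<close> the fibre sum is
  \<open>m ln |a| + \<Sum> ln |V(\<alpha>) - e\<^sup>i\<^sup>t|\<close>, and Jensen's formula yields
  \<open>M(P) = |a| \<Prod> max(1, |V(\<alpha>)|)\<^sup>1\<^sup>/\<^sup>m\<close>. The equality case for irreducible \<open>P\<close> is Kronecker's theorem
  for the numbers \<open>V(\<alpha>)\<close>.

  The covering statement is a local computation: near a regular value of the circle the inverse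
  branches of \<open>V\<close> are almost similarities, which determines the Hausdorff measure of short arcs up
  to a factor close to 1. Finitely many critical values carry no mass.
\<close>

section \<open>One-dimensional Hausdorff measure\<close>

text \<open>No parametrization of the lemniscate is chosen. Two Borel measures on the line of angles
  are compared instead: the push-forward of \<open>f |V'|\<close> times arc length under the
  argument of \<open>V\<close>, and the fibre sum of \<open>f\<close> times Lebesgue measure. Both
  assign to a short interval around a regular angle almost the same multiple of its length. Errors
  proportional to length add up under subdivision, so bisection makes the two measures agree. This
  comparison is carried out with nonnegative extended integrals, whereas \<open>ln |P|\<close>
  changes sign and tends to minus infinity at the zeros of \<open>P\<close>. It is bounded above on
  the bounded set \<open>L\<close>, so \<open>B - ln |P|\<close> is integrated in its place, and the
  total mass 1 of the measure gives the constant \<open>B\<close> back. Kronecker's argument takes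
  place in Z[z] modulo \<open>P\<close> and ends with \<open>P dvd V\<close> or
  \<open>P dvd V ^ n - 1\<close>. The cyclotomic polynomial is then read off at a single root of
  \<open>P\<close>, and irreducibility of \<open>P\<close> turns the vanishing there into
  divisibility.\<close>

lemma diameter_le_dist:
  fixes S :: "'a::metric_space set"
  assumes "0 \<le> d" "\<And>x y. x \<in> S \<Longrightarrow> y \<in> S \<Longrightarrow> dist x y \<le> d"
  shows "diameter S \<le> d"
  using assms by (auto simp: diameter_def intro!: cSUP_least)

lemma hausdorff1_premeasure_le:
  assumes "A \<subseteq> (\<Union>i. U i)" "\<And>i. bounded (U i)" "\<And>i. diameter (U i) \<le> \<delta>"
  shows "hausdorff1_premeasure \<delta> A \<le> (\<Sum>i. ennreal (diameter (U i)))"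
  unfolding hausdorff1_premeasure_def by (rule INF_lower) (use assms in auto)

lemma hausdorff1_premeasure_mono:
  assumes "A \<subseteq> B" "\<delta>' \<le> \<delta>"
  shows "hausdorff1_premeasure \<delta> A \<le> hausdorff1_premeasure \<delta>' B"
  unfolding hausdorff1_premeasure_def using assms
  by (intro INF_superset_mono) (auto intro: order_trans)

lemma hausdorff1_premeasure_le_outer:
  "0 < \<delta> \<Longrightarrow> hausdorff1_premeasure \<delta> A \<le> hausdorff1_outer A"
  unfolding hausdorff1_outer_def by (rule SUP_upper) auto

lemma hausdorff1_outer_mono: "A \<subseteq> B \<Longrightarrow> hausdorff1_outer A \<le> hausdorff1_outer B"
  unfolding hausdorff1_outer_def by (intro SUP_mono) (auto intro: hausdorff1_premeasure_mono)

lemma hausdorff1_outer_singleton [simp]: "hausdorff1_outer {x} = 0"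
proof -
  have "hausdorff1_premeasure \<delta> {x} \<le> 0" if "\<delta> > 0" for \<delta>
    using hausdorff1_premeasure_le[of "{x}" "\<lambda>i::nat. {x}" \<delta>] that by simp
  then show ?thesis
    unfolding hausdorff1_outer_def by (simp add: SUP_eq_iff)
qed

lemma hausdorff1_outer_empty [simp]: "hausdorff1_outer {} = 0"
  using hausdorff1_outer_mono[of "{}" "{undefined}"] by simp

text \<open>Near-optimal covers of the single sets, with errors \<open>e * (1/2) ^ Suc n\<close>,
  merge into one cover with total error \<open>e\<close>. The bound on the diameters is inherited,
  so subadditivity holds already at a fixed scale \<open>\<delta>\<close>.\<close>

lemma hausdorff1_premeasure_UN:
  "hausdorff1_premeasure \<delta> (\<Union>i. A i) \<le> (\<Sum>i::nat. hausdorff1_premeasure \<delta> (A i))"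
proof (rule ennreal_le_epsilon)
  fix e :: real
  assume "0 < e" and "(\<Sum>i. hausdorff1_premeasure \<delta> (A i)) < top"
  \<comment> \<open>Finiteness of the sum makes each term finite; for an infinite term the strict
    inequality would fail.\<close>
  then have "hausdorff1_premeasure \<delta> (A n)
               < hausdorff1_premeasure \<delta> (A n) + e * (1/2)^Suc n" for n
    by (auto simp add: less_top dest!: ennreal_suminf_lessD)
  then have "\<exists>U. A n \<subseteq> (\<Union>i. U i) \<and> (\<forall>i::nat. bounded (U i) \<and> diameter (U i) \<le> \<delta>) \<and>
               (\<Sum>i. ennreal (diameter (U i))) \<le> hausdorff1_premeasure \<delta> (A n) + e * (1/2)^Suc n" for n
    by (subst (asm) (1) hausdorff1_premeasure_def) (simp add: INF_less_iff, meson less_imp_le)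
  then obtain U where U: "\<And>n. A n \<subseteq> (\<Union>i. U n i)"
      "\<And>n i::nat. bounded (U n i)" "\<And>n i. diameter (U n i) \<le> \<delta>"
      "\<And>n. (\<Sum>i. ennreal (diameter (U n i))) \<le> hausdorff1_premeasure \<delta> (A n) + e * (1/2)^Suc n"
    by metis
  define C where "C = case_prod U o prod_decode"
  have "hausdorff1_premeasure \<delta> (\<Union>i. A i) \<le> (\<Sum>i. ennreal (diameter (C i)))"
  proof (rule hausdorff1_premeasure_le)
    show "(\<Union>i. A i) \<subseteq> (\<Union>i. C i)"
      using U(1) by (auto simp add: C_def subset_eq) (metis prod.case prod_encode_inverse)
  qed (use U in \<open>auto simp: C_def split: prod.split\<close>)
  also have "\<dots> = (\<Sum>n. \<Sum>i. ennreal (diameter (U n i)))"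
    using suminf_ennreal_2dimen[of "\<lambda>n. \<Sum>i. ennreal (diameter (U n i))"
        "\<lambda>(n,i). ennreal (diameter (U n i))"]
    by (simp add: C_def split_def)
  also have "\<dots> \<le> (\<Sum>n. hausdorff1_premeasure \<delta> (A n) + e * (1/2) ^ Suc n)"
    by (intro suminf_le U) auto
  also have "\<dots> = (\<Sum>n. hausdorff1_premeasure \<delta> (A n)) + (\<Sum>n. ennreal e * ennreal ((1/2) ^ Suc n))"
    using \<open>0 < e\<close> by (subst suminf_add[symmetric])
                     (auto simp del: ennreal_suminf_cmult simp add: ennreal_mult[symmetric])
  also have "\<dots> = (\<Sum>n. hausdorff1_premeasure \<delta> (A n)) + e"
    unfolding ennreal_suminf_cmult
    by (subst suminf_ennreal_eq[OF zero_le_power power_half_series]) auto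
  finally show "hausdorff1_premeasure \<delta> (\<Union>i. A i) \<le> (\<Sum>n. hausdorff1_premeasure \<delta> (A n)) + e" .
qed

section \<open>Metric outer measures and the measurability of Borel sets\<close>

lemma outer_measure_space_hausdorff1: "outer_measure_space (Pow UNIV) hausdorff1_outer"
  unfolding outer_measure_space_def
proof (intro conjI)
  show "countably_subadditive (Pow UNIV) (hausdorff1_outer :: 'a set \<Rightarrow> ennreal)"
    unfolding countably_subadditive_def
  proof safe
    fix A :: "nat \<Rightarrow> 'a set"
    have "hausdorff1_premeasure \<delta> (\<Union>i. A i) \<le> (\<Sum>i. hausdorff1_outer (A i))" if "\<delta> > 0" for \<delta>
      by (rule order_trans[OF hausdorff1_premeasure_UN])
         (auto intro!: suminf_le hausdorff1_premeasure_le_outer that)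
    then show "hausdorff1_outer (\<Union>i. A i) \<le> (\<Sum>i. hausdorff1_outer (A i))"
      unfolding hausdorff1_outer_def[of "\<Union>i. A i"] by (auto intro: SUP_least)
  qed
qed (auto simp: positive_def increasing_def intro: hausdorff1_outer_mono)

text \<open>A covering set of diameter below \<open>r\<close> cannot meet both \<open>A\<close> and
  \<open>B\<close>, so a fine cover of the union splits into a cover of \<open>A\<close> and one of
  \<open>B\<close>. This additivity is the hypothesis of Caratheodory's criterion for metric outer
  measures.\<close>

lemma hausdorff1_outer_separated:
  assumes r: "r > 0" "\<And>x y. x \<in> A \<Longrightarrow> y \<in> B \<Longrightarrow> r \<le> dist x y"
  shows "hausdorff1_outer A + hausdorff1_outer B \<le> hausdorff1_outer (A \<union> B)"
proof -
  have *: "hausdorff1_premeasure \<delta> A + hausdorff1_premeasure \<delta> B \<le> hausdorff1_premeasure \<delta> (A \<union> B)"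
    if "\<delta> < r" for \<delta>
    unfolding hausdorff1_premeasure_def[of \<delta> "A \<union> B"]
  proof (rule INF_greatest, safe)
    fix U :: "nat \<Rightarrow> 'a set"
    assume cov: "A \<union> B \<subseteq> (\<Union>i. U i)" and U: "\<forall>i. bounded (U i) \<and> diameter (U i) \<le> \<delta>"
    have sub: "diameter (U i \<inter> S) \<le> diameter (U i)" for i S
      using U by (intro diameter_subset) auto
    have "hausdorff1_premeasure \<delta> A \<le> (\<Sum>i. ennreal (diameter (U i \<inter> A)))"
      using cov U sub by (intro hausdorff1_premeasure_le) (auto intro: order_trans bounded_subset)
    moreover have "hausdorff1_premeasure \<delta> B \<le> (\<Sum>i. ennreal (diameter (U i \<inter> B)))"
      using cov U sub by (intro hausdorff1_premeasure_le) (auto intro: order_trans bounded_subset)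
    ultimately have "hausdorff1_premeasure \<delta> A + hausdorff1_premeasure \<delta> B
        \<le> (\<Sum>i. ennreal (diameter (U i \<inter> A))) + (\<Sum>i. ennreal (diameter (U i \<inter> B)))"
      by (rule add_mono)
    also have "\<dots> = (\<Sum>i. ennreal (diameter (U i \<inter> A)) + ennreal (diameter (U i \<inter> B)))"
      by (rule suminf_add) auto
    also have "\<dots> \<le> (\<Sum>i. ennreal (diameter (U i)))"
    proof (intro suminf_le allI)
      fix i
      have "U i \<inter> A = {} \<or> U i \<inter> B = {}"
      proof (rule ccontr)
        assume "\<not> ?thesis"
        then obtain x y where "x \<in> U i" "x \<in> A" "y \<in> U i" "y \<in> B" by auto
        with diameter_bounded_bound[of "U i" x y] U r(2)[of x y] that show False
          by (meson le_less_trans less_le_trans not_le)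
      qed
      then show "ennreal (diameter (U i \<inter> A)) + ennreal (diameter (U i \<inter> B)) \<le> ennreal (diameter (U i))"
        using sub[of i A] sub[of i B] by (auto intro: ennreal_leI)
    qed auto
    finally show "hausdorff1_premeasure \<delta> A + hausdorff1_premeasure \<delta> B
                    \<le> (\<Sum>i. ennreal (diameter (U i)))" .
  qed
  \<comment> \<open>The suprema defining the two outer measures run over independent scales, hence
    two scales here; both are refined to a common one below \<open>r\<close>.\<close>
  have **: "hausdorff1_premeasure \<delta>1 A + hausdorff1_premeasure \<delta>2 B \<le> hausdorff1_outer (A \<union> B)"
    if "\<delta>1 > 0" "\<delta>2 > 0" for \<delta>1 \<delta>2
  proof -
    define \<delta> where "\<delta> = min (r/2) (min \<delta>1 \<delta>2)"
    have "hausdorff1_premeasure \<delta>1 A + hausdorff1_premeasure \<delta>2 B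
            \<le> hausdorff1_premeasure \<delta> A + hausdorff1_premeasure \<delta> B"
      by (intro add_mono hausdorff1_premeasure_mono) (auto simp: \<delta>_def)
    also have "\<dots> \<le> hausdorff1_premeasure \<delta> (A \<union> B)"
      using r by (intro *) (auto simp: \<delta>_def min_def)
    also have "\<dots> \<le> hausdorff1_outer (A \<union> B)"
      using that r by (intro hausdorff1_premeasure_le_outer) (auto simp: \<delta>_def)
    finally show ?thesis .
  qed
  have "hausdorff1_premeasure \<delta>1 A + hausdorff1_outer B \<le> hausdorff1_outer (A \<union> B)" if "\<delta>1 > 0" for \<delta>1
    unfolding hausdorff1_outer_def[of B]
    by (subst ennreal_SUP_add_right) (auto intro!: SUP_least ** that)
  then show ?thesis
    unfolding hausdorff1_outer_def[of A]
    by (subst ennreal_SUP_add_left[symmetric]) (auto intro!: SUP_least)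
qed

text \<open>Caratheodory's criterion. The part of \<open>A\<close> outside \<open>C\<close> is
  exhausted by the sets \<open>D n\<close> at distance at least \<open>1 / (n + 1)\<close> from
  \<open>C\<close>, which are separated from \<open>A \<inter> C\<close>. What \<open>D n\<close>
  misses lies in the shells \<open>R k\<close> with \<open>k \<ge> n\<close>. Shells of equal parity
  are separated from each other, so the series of their masses converges and its tails
  vanish.\<close>

lemma closed_in_lambda_system:
  fixes f :: "'a::metric_space set \<Rightarrow> ennreal"
  assumes oms: "outer_measure_space (Pow UNIV) f"
    and sep: "\<And>A B r. r > 0 \<Longrightarrow> (\<And>x y. x \<in> A \<Longrightarrow> y \<in> B \<Longrightarrow> r \<le> dist x y) \<Longrightarrow> f A + f B \<le> f (A \<union> B)"
    and C: "closed C"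
  shows "C \<in> lambda_system UNIV (Pow UNIV) f"
proof -
  have mono: "f X \<le> f Y" if "X \<subseteq> Y" for X Y
    using oms that by (auto simp: outer_measure_space_def increasing_def)
  have empty: "f {} = 0"
    using oms by (auto simp: outer_measure_space_def positive_def)
  interpret sigma_algebra "UNIV :: 'a set" "Pow UNIV" by (rule sigma_algebra_Pow)
  have subadd: "f (X \<union> Y) \<le> f X + f Y" for X Y
    using countably_subadditive_subadditive[of f] oms
    by (auto simp: outer_measure_space_def subadditive_def)
       (metis Diff_disjoint Un_Diff_cancel add_left_mono mono order_trans Diff_subset)
  have csub: "f (\<Union>i::nat. X i) \<le> (\<Sum>i. f (X i))" for X
  proof -
    have "f (\<Union>i. X i) = f (\<Union>i. disjointed X i)" by (simp add: UN_disjointed_eq)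
    also have "\<dots> \<le> (\<Sum>i. f (disjointed X i))"
      using oms disjoint_family_disjointed[of X]
      by (auto simp: outer_measure_space_def countably_subadditive_def)
    also have "\<dots> \<le> (\<Sum>i. f (X i))"
      by (intro suminf_le mono disjointed_subset) auto
    finally show ?thesis .
  qed
  have sep': "f X + f Y \<le> f (X \<union> Y)"
    if "b < a" "\<And>x. x \<in> X \<Longrightarrow> a \<le> infdist x C" "\<And>y. y \<in> Y \<Longrightarrow> infdist y C \<le> b" for X Y a b
  proof (rule sep[of "a - b"])
    fix x y assume "x \<in> X" "y \<in> Y"
    then show "a - b \<le> dist x y"
      using infdist_triangle[of x C y] that(2)[of x] that(3)[of y] by simp
  qed (use that in auto)
  have main: "f (A \<inter> C) + f (A - C) \<le> f A" if ne: "C \<noteq> {}" and fin: "f A < top" for A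
  proof -
    define D where "D n = {x \<in> A. 1 / (real n + 1) \<le> infdist x C}" for n :: nat
    define R where "R n = D (Suc n) - D n" for n
    have Rlow: "1 / (real n + 2) \<le> infdist x C" and Rup: "infdist x C \<le> 1 / (real n + 1)"
      if "x \<in> R n" for x n
      using that by (auto simp: R_def D_def add_ac)
    have RA: "R n \<subseteq> A" for n by (auto simp: R_def D_def)
    have part: "(\<Sum>k<n. f (R (2*k + j))) \<le> f A" for n j
    proof -
      have "(\<Sum>k<n. f (R (2*k + j))) \<le> f (\<Union>k<n. R (2*k + j))"
      proof (induction n)
        case (Suc n)
        have "(\<Sum>k<Suc n. f (R (2*k + j))) \<le> f (\<Union>k<n. R (2*k + j)) + f (R (2*n + j))"
          using Suc by (auto intro: add_right_mono)
        also have "\<dots> \<le> f ((\<Union>k<n. R (2*k + j)) \<union> R (2*n + j))"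
        \<comment> \<open>For \<open>n = 0\<close> the union is empty, and with \<open>j = 0\<close>
          the level \<open>1 / real (2*n+j)\<close> would be a division by zero.\<close>
        proof (cases "n = 0")
          case False
          show ?thesis
          proof (rule sep'[of "1 / (real (2*n+j) + 1)" "1 / real (2*n+j)"])
            show "1 / (real (2 * n + j) + 1) < 1 / real (2 * n + j)"
              using False by (simp add: field_simps)
            fix x assume "x \<in> (\<Union>k<n. R (2*k + j))"
            then obtain k where "k < n" "x \<in> R (2*k+j)" by auto
            then show "1 / real (2*n+j) \<le> infdist x C"
              by (intro order_trans[OF _ Rlow[of x "2*k+j"]] divide_left_mono) auto
          qed (use Rup in blast)
        qed (auto simp: empty)
        also have "(\<Union>k<n. R (2*k + j)) \<union> R (2*n + j) = (\<Union>k<Suc n. R (2*k + j))"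
          by (auto simp: less_Suc_eq)
        finally show ?case .
      qed (auto simp: empty)
      also have "\<dots> \<le> f A" using RA by (intro mono) auto
      finally show ?thesis .
    qed
    \<comment> \<open>The even and the odd shells contribute at most \<open>f A\<close>
      each.\<close>
    have "(\<Sum>k<n. f (R k)) \<le> f A + f A" for n
    proof -
      have "(\<Sum>k<n. f (R k)) \<le> (\<Sum>k<2*n. f (R k))"
        by (intro sum_mono2) auto
      also have "\<dots> = (\<Sum>k<n. f (R (2*k+0))) + (\<Sum>k<n. f (R (2*k+1)))"
        by (induction n) (auto simp: algebra_simps)
      also have "\<dots> \<le> f A + f A" by (intro add_mono part)
      finally show ?thesis .
    qed
    then have "(\<Sum>k. f (R k)) \<le> f A + f A"
      by (intro suminf_le_const) auto
    then have finR: "(\<Sum>k. f (R k)) \<noteq> top"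
      using fin by (auto simp: top_unique)
    define g where "g k = enn2real (f (R k))" for k
    have fg: "f (R k) = ennreal (g k)" for k
      unfolding g_def using mono[OF RA[of k]] fin by simp
    have gpos: "g k \<ge> 0" for k by (simp add: g_def)
    have sg: "summable g"
      using finR unfolding fg by (rule summable_suminf_not_top[rotated]) (simp add: gpos)
    have tail: "(\<lambda>n. \<Sum>k. g (k + n)) \<longlonglongrightarrow> 0"
      by (rule suminf_exist_split2[OF sg])
    have cover: "A - C \<subseteq> D n \<union> (\<Union>k. R (k + n))" for n
    proof
      fix x assume x: "x \<in> A - C"
      \<comment> \<open>Closedness of \<open>C\<close> enters here: a point outside \<open>C\<close>
        has positive distance from it and so lies in some \<open>D m\<close>.\<close>
      then have pos: "infdist x C > 0"
        using infdist_pos_not_in_closed[OF C ne] by auto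
      obtain m where m: "1 / (real m + 1) \<le> infdist x C"
        using pos by (metis less_imp_le nat_approx_posE of_nat_Suc add.commute)
      then have ex: "\<exists>m. x \<in> D m" using x by (auto simp: D_def)
      define N where "N = (LEAST m. x \<in> D m)"
      have N: "x \<in> D N" unfolding N_def using ex by (rule LeastI_ex)
      have Nl: "x \<notin> D k" if "k < N" for k
        using that unfolding N_def by (rule not_less_Least)
      show "x \<in> D n \<union> (\<Union>k. R (k + n))"
      proof (cases "N \<le> n")
        case True
        then have "1 / (real n + 1) \<le> 1 / (real N + 1)" by (simp add: field_simps)
        with N have "x \<in> D n" by (auto simp: D_def)
        then show ?thesis by simp
      next
        case False
        then obtain k where k: "N = Suc (k + n)"
          by (metis add.commute less_natE not_le add_Suc_right)
        with N Nl[of "k+n"] have "x \<in> R (k+n)" by (auto simp: R_def)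
        then show ?thesis by blast
      qed
    qed
    have bound: "f (A \<inter> C) + f (A - C) \<le> f A + ennreal (\<Sum>k. g (k + n))" for n
    proof -
      have "f (A - C) \<le> f (D n) + f (\<Union>k. R (k + n))"
        using mono[OF cover[of n]] subadd order_trans by blast
      also have "f (\<Union>k. R (k + n)) \<le> (\<Sum>k. f (R (k+n)))" by (rule csub)
      also have "\<dots> = ennreal (\<Sum>k. g (k + n))"
        unfolding fg by (rule suminf_ennreal2) (use gpos sg in \<open>auto simp: summable_iff_shift\<close>)
      finally have "f (A \<inter> C) + f (A - C) \<le> (f (D n) + f (A \<inter> C)) + ennreal (\<Sum>k. g (k + n))"
        by (simp add: add_ac add_left_mono)
      also have "f (D n) + f (A \<inter> C) \<le> f (D n \<union> (A \<inter> C))"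
        by (rule sep'[of 0 "1 / (real n + 1)"]) (auto simp: D_def)
      also have "\<dots> \<le> f A" by (rule mono) (auto simp: D_def)
      finally show ?thesis by (simp add: add_right_mono)
    qed
    show ?thesis
    proof (rule ennreal_le_epsilon)
      fix e :: real assume "e > 0"
      then obtain n where "(\<Sum>k. g (k + n)) < e"
        using order_tendstoD(2)[OF tail] by (auto simp: eventually_sequentially)
      then show "f (A \<inter> C) + f (A - C) \<le> f A + ennreal e"
        by (intro order_trans[OF bound[of n]] add_left_mono ennreal_leI) auto
    qed
  qed
  have "f (A \<inter> C) + f (A - C) = f A" for A
  proof (rule antisym)
    show "f (A \<inter> C) + f (A - C) \<le> f A"
      using main[of A] empty by (cases "C = {}"; cases "f A < top") (auto simp: not_less top_unique)
    show "f A \<le> f (A \<inter> C) + f (A - C)"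
      using subadd[of "A \<inter> C" "A - C"] by (simp add: Int_Diff_Un)
  qed
  then show ?thesis unfolding lambda_system_eq by simp
qed

lemma measure_space_hausdorff1:
  "measure_space UNIV (sets borel) (hausdorff1_outer :: 'a::metric_space set \<Rightarrow> ennreal)"
proof -
  let ?L = "lambda_system UNIV (Pow UNIV) (hausdorff1_outer :: 'a set \<Rightarrow> ennreal)"
  have ms: "measure_space UNIV ?L hausdorff1_outer"
    using sigma_algebra.caratheodory_lemma[OF sigma_algebra_Pow outer_measure_space_hausdorff1] .
  then interpret L: sigma_algebra UNIV ?L by (simp add: measure_space_def)
  have "Collect closed \<subseteq> ?L"
    using closed_in_lambda_system[OF outer_measure_space_hausdorff1] hausdorff1_outer_separated
    by blast
  then have "sigma_sets UNIV (Collect closed) \<subseteq> ?L"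
    by (rule L.sigma_sets_subset)
  then have sub: "sets (borel :: 'a measure) \<subseteq> ?L"
    by (simp add: borel_eq_closed)
  have "sigma_algebra UNIV (sets (borel :: 'a measure))"
    by (metis sets.sigma_algebra_axioms space_borel)
  then show ?thesis using measure_down[OF ms _ sub] by blast
qed

section \<open>Arc length as a Borel measure, Lipschitz maps and intervals\<close>

lemma sets_arc_length [simp, measurable_cong]: "sets arc_length = sets borel"
proof -
  have "sets arc_length = sigma_sets UNIV (sets borel)"
    unfolding arc_length_def by (rule sets_measure_of) simp
  also have "\<dots> = sets borel"
    by (metis sets.sigma_sets_eq space_borel)
  finally show ?thesis .
qed

lemma space_arc_length [simp]: "space arc_length = UNIV"
  by (simp add: arc_length_def)

text \<open>\<open>measure_of\<close> silently yields the zero measure when its argument is not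
  countably additive; \<open>measure_space_hausdorff1\<close> excludes this.\<close>

lemma emeasure_arc_length:
  assumes "A \<in> sets borel" shows "emeasure arc_length A = hausdorff1_outer A"
  using measure_space_hausdorff1 assms unfolding arc_length_def
  by (intro emeasure_measure_of_sigma) (auto simp: measure_space_def)

text \<open>A cover of \<open>A\<close> at scale \<open>\<delta> / K\<close>, intersected with
  \<open>A\<close> and mapped by \<open>g\<close>, is a cover of the image at scale
  \<open>\<delta>\<close>, with diameters enlarged at most by the factor \<open>K\<close>.\<close>

lemma hausdorff1_outer_Lipschitz_image:
  fixes g :: "'a::metric_space \<Rightarrow> 'b::metric_space"
  assumes K: "K > 0" and lip: "\<And>x y. x \<in> A \<Longrightarrow> y \<in> A \<Longrightarrow> dist (g x) (g y) \<le> K * dist x y"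
  shows "hausdorff1_outer (g ` A) \<le> ennreal K * hausdorff1_outer A"
proof -
  have "hausdorff1_premeasure \<delta> (g ` A) \<le> ennreal K * hausdorff1_outer A" if \<delta>: "\<delta> > 0" for \<delta>
  proof -
    \<comment> \<open>Dividing by \<open>K\<close> leaves the infimum over covers alone on the
      right, where it can be treated cover by cover.\<close>
    have "hausdorff1_premeasure \<delta> (g ` A) / ennreal K \<le> hausdorff1_premeasure (\<delta> / K) A"
      unfolding hausdorff1_premeasure_def[of "\<delta>/K"]
    proof (rule INF_greatest, safe)
      fix U :: "nat \<Rightarrow> 'a set"
      assume cov: "A \<subseteq> (\<Union>i. U i)" and U: "\<forall>i. bounded (U i) \<and> diameter (U i) \<le> \<delta> / K"
      have d: "dist (g x) (g y) \<le> K * diameter (U i)"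
        if "x \<in> U i \<inter> A" "y \<in> U i \<inter> A" for i x y
        using lip[of x y] diameter_bounded_bound[of "U i" x y] U that K
        by (meson IntD1 IntD2 mult_left_mono order_less_imp_le order_trans)
      have diam: "diameter (g ` (U i \<inter> A)) \<le> K * diameter (U i)" for i
        using d K U by (intro diameter_le_dist) (auto intro!: mult_nonneg_nonneg diameter_ge_0)
      have "hausdorff1_premeasure \<delta> (g ` A) \<le> (\<Sum>i. ennreal (diameter (g ` (U i \<inter> A))))"
      proof (rule hausdorff1_premeasure_le)
        show "g ` A \<subseteq> (\<Union>i. g ` (U i \<inter> A))" using cov by blast
        show "bounded (g ` (U i \<inter> A))" for i
          unfolding bounded_two_points using d by blast
        show "diameter (g ` (U i \<inter> A)) \<le> \<delta>" for i
          using diam[of i] U[rule_format, of i] K by (simp add: field_simps)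
      qed
      also have "\<dots> \<le> (\<Sum>i. ennreal K * ennreal (diameter (U i)))"
        using diam K U by (intro suminf_le) (auto simp: ennreal_mult[symmetric] diameter_ge_0 intro!: ennreal_leI)
      also have "\<dots> = ennreal K * (\<Sum>i. ennreal (diameter (U i)))" by simp
      finally show "hausdorff1_premeasure \<delta> (g ` A) / ennreal K \<le> (\<Sum>i. ennreal (diameter (U i)))"
        using K by (simp add: divide_le_posI_ennreal)
    qed
    also have "\<dots> \<le> hausdorff1_outer A"
      using K \<delta> by (intro hausdorff1_premeasure_le_outer) auto
    finally have *: "ennreal K * (hausdorff1_premeasure \<delta> (g ` A) / ennreal K) \<le> ennreal K * hausdorff1_outer A"
      by (rule mult_left_mono) auto
    have "ennreal K * (hausdorff1_premeasure \<delta> (g ` A) / ennreal K) = hausdorff1_premeasure \<delta> (g ` A)"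
      using K by (subst ennreal_times_divide, subst mult.commute, intro ennreal_mult_divide_eq) auto
    with * show ?thesis by simp
  qed
  then show ?thesis
    unfolding hausdorff1_outer_def[of "g ` A"] by (auto intro!: SUP_least)
qed

text \<open>The upper bound cuts the interval into equal pieces. For the lower bound, each covering
  set is replaced by its closed hull, which is no longer than the diameter, and Lebesgue measure is
  subadditive.\<close>

lemma hausdorff1_outer_interval:
  fixes c d :: real
  assumes cd: "c \<le> d"
  shows "hausdorff1_outer {c<..d} = ennreal (d - c)"
proof (rule antisym)
  have "hausdorff1_premeasure \<delta> {c<..d} \<le> ennreal (d - c)" if \<delta>: "\<delta> > 0" for \<delta>
  proof -
    \<comment> \<open>With this many pieces the step \<open>h\<close> is at most
      \<open>\<delta>\<close>.\<close>
    obtain n :: nat where n: "(d - c) / \<delta> < real n" using reals_Archimedean2 by blast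
    have "0 \<le> (d - c) / \<delta>" using cd \<delta> by simp
    with n have n0: "n > 0" by (intro gr0I) auto
    define h where "h = (d - c) / real n"
    have h: "0 \<le> h" "h \<le> \<delta>" "real n * h = d - c"
      using n n0 cd \<delta> by (auto simp: h_def field_simps)
    define U where "U i = (if i < n then {c + real i * h .. c + real i * h + h} else {})" for i
    have "hausdorff1_premeasure \<delta> {c<..d} \<le> (\<Sum>i. ennreal (diameter (U i)))"
    proof (rule hausdorff1_premeasure_le)
      show "{c<..d} \<subseteq> (\<Union>i. U i)"
      proof
        fix x assume x: "x \<in> {c<..d}"
        then have hp: "h > 0" using cd n0 by (simp add: h_def)
        \<comment> \<open>The index with \<open>c + i * h < x \<le> c + (i + 1) * h\<close>: ceiling
          minus one rather than floor, so that \<open>x = d\<close> falls into the last piece and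
          not beyond it.\<close>
        define i where "i = nat \<lceil>(x - c) / h\<rceil> - 1"
        have pos: "(x - c) / h > 0" using x hp by simp
        then have "\<lceil>(x - c) / h\<rceil> \<ge> 1" by (simp add: less_ceiling_iff)
        then have ri: "real i = of_int \<lceil>(x - c) / h\<rceil> - 1"
          unfolding i_def by linarith
        have "(x - c) / h \<le> real i + 1" "real i < (x - c) / h"
          unfolding ri by linarith+
        then have b: "x \<le> c + real i * h + h" "c + real i * h < x"
          using hp by (auto simp: field_simps)
        have "real i * h < real n * h" using b x h(3) by simp
        then have "i < n" using hp by simp
        with b have "x \<in> U i" by (simp add: U_def)
        then show "x \<in> (\<Union>i. U i)" by blast
      qed
    qed (use h \<delta> in \<open>auto simp: U_def\<close>)
    also have "\<dots> = (\<Sum>i<n. ennreal (diameter (U i)))"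
      by (rule suminf_finite) (auto simp: U_def)
    also have "\<dots> = (\<Sum>i<n. ennreal h)"
      using h by (intro sum.cong) (auto simp: U_def)
    also have "\<dots> = ennreal (d - c)"
      using h by (simp add: ennreal_of_nat_eq_real_of_nat ennreal_mult[symmetric])
    finally show ?thesis .
  qed
  then show "hausdorff1_outer {c<..d} \<le> ennreal (d - c)"
    unfolding hausdorff1_outer_def by (auto intro: SUP_least)
next
  have "ennreal (d - c) \<le> hausdorff1_premeasure 1 {c<..d}"
    unfolding hausdorff1_premeasure_def
  proof (rule INF_greatest, safe)
    fix U :: "nat \<Rightarrow> real set"
    assume cov: "{c<..d} \<subseteq> (\<Union>i. U i)" and U: "\<forall>i. bounded (U i) \<and> diameter (U i) \<le> 1"
    have "\<exists>a b. U i \<subseteq> {a..b} \<and> a \<le> b \<and> b - a \<le> diameter (U i)" for i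
    proof (cases "U i = {}")
      case False
      have bd: "bdd_below (U i)" "bdd_above (U i)"
        using U by (auto intro: bounded_imp_bdd_below bounded_imp_bdd_above)
      obtain y where y: "y \<in> U i" using False by blast
      have "Sup (U i) \<le> Inf (U i) + diameter (U i)"
      proof (rule cSup_least[OF False])
        fix x assume x: "x \<in> U i"
        have "x - diameter (U i) \<le> Inf (U i)"
        proof (rule cInf_greatest[OF False])
          fix z assume "z \<in> U i"
          then show "x - diameter (U i) \<le> z"
            using diameter_bounded_bound[of "U i" x z] U x by (auto simp: dist_real_def)
        qed
        then show "x \<le> Inf (U i) + diameter (U i)" by simp
      qed
      moreover have "U i \<subseteq> {Inf (U i)..Sup (U i)}"
        using bd by (auto intro: cInf_lower cSup_upper)
      ultimately show ?thesis using y by (intro exI[of _ "Inf (U i)"] exI[of _ "Sup (U i)"]) auto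
    qed (auto intro!: exI[of _ 0])
    then obtain a b where ab: "\<And>i. U i \<subseteq> {a i..b i}" "\<And>i. a i \<le> b i" "\<And>i. b i - a i \<le> diameter (U i)"
      by metis
    have "ennreal (d - c) = emeasure lborel {c<..d}" using cd by simp
    also have "\<dots> \<le> emeasure lborel (\<Union>i. {a i..b i})"
    proof (rule emeasure_mono)
      show "{c<..d} \<subseteq> (\<Union>i. {a i..b i})" using cov ab(1) by blast
    qed simp
    also have "\<dots> \<le> (\<Sum>i. emeasure lborel {a i..b i})"
      by (rule emeasure_subadditive_countably) auto
    also have "\<dots> \<le> (\<Sum>i. ennreal (diameter (U i)))"
      using ab by (intro suminf_le) (auto intro!: ennreal_leI)
    finally show "ennreal (d - c) \<le> (\<Sum>i. ennreal (diameter (U i)))" .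
  qed
  also have "\<dots> \<le> hausdorff1_outer {c<..d}"
    by (rule hausdorff1_premeasure_le_outer) simp
  finally show "ennreal (d - c) \<le> hausdorff1_outer {c<..d}" .
qed

lemma finite_null_arc_length: "finite A \<Longrightarrow> A \<in> null_sets arc_length"
proof (induction rule: finite_induct)
  case (insert x A)
  have "{x} \<in> null_sets arc_length" by (rule null_setsI) (auto simp: emeasure_arc_length)
  from null_sets.Un[OF this insert.IH] show ?case by simp
qed simp

section \<open>Comparing measures on the line\<close>

lemma emeasure_interval_add:
  fixes M :: "real measure"
  assumes "sets M = sets borel" "a \<le> b" "b \<le> c"
  shows "emeasure M {a<..c} = emeasure M {a<..b} + emeasure M {b<..c}"
proof -
  have "{a<..c} = {a<..b} \<union> {b<..c}" using assms by auto
  then show ?thesis using assms by (subst plus_emeasure) auto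
qed

text \<open>Near \<open>t\<close> both measures follow the same linear function of the length with
  slope error \<open>e\<close>, so they differ by a small multiple of the length. That kind of error
  is additive, hence the comparison passes from short intervals to \<open>{c<..d}\<close> by
  bisection, and \<open>e\<close> is arbitrary. Half-open intervals make adjacent pieces
  disjoint.\<close>

lemma measures_eq_interval_local:
  fixes M N :: "real measure"
  assumes M: "sets M = sets borel" and N: "sets N = sets borel" and cd: "c \<le> d"
    and local: "\<And>t e. c \<le> t \<Longrightarrow> t \<le> d \<Longrightarrow> e > 0 \<Longrightarrow>
      \<exists>r. \<exists>\<delta>>0. \<forall>a b. a \<le> t \<and> t \<le> b \<and> b - a < \<delta> \<longrightarrow>
        (\<forall>K\<in>{M, N}. ennreal ((r - e) * (b - a)) \<le> emeasure K {a<..b} \<and>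
                     emeasure K {a<..b} \<le> ennreal ((r + e) * (b - a)))"
  shows "emeasure M {c<..d} = emeasure N {c<..d}"
proof -
  have key: "emeasure M {c<..d} \<le> emeasure N {c<..d} + ennreal (e * (d - c)) \<and>
             emeasure N {c<..d} \<le> emeasure M {c<..d} + ennreal (e * (d - c))" if e: "e > 0" for e
    using cd
  proof (induction rule: Bolzano)
    case (trans a b c)
    have *: "ennreal (e * (c - a)) = ennreal (e * (b - a)) + ennreal (e * (c - b))"
      using trans e by (subst ennreal_plus[symmetric]) (auto simp: algebra_simps)
    have "x1 + x2 \<le> (y1 + y2) + (z1 + z2)" if "x1 \<le> y1 + z1" "x2 \<le> y2 + z2"
      for x1 x2 y1 y2 z1 z2 :: ennreal
      using add_mono[OF that] by (simp add: ac_simps)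
    then show ?case
      unfolding * emeasure_interval_add[OF M trans(3,4)] emeasure_interval_add[OF N trans(3,4)]
      using trans(1,2) by blast
  next
    case (local t)
    have "e / 2 > 0" using e by simp
    from assms(4)[OF local this] obtain r \<delta> where \<delta>: "\<delta> > 0" and
      b: "\<forall>a b. a \<le> t \<and> t \<le> b \<and> b - a < \<delta> \<longrightarrow> (\<forall>K\<in>{M, N}.
            ennreal ((r - e/2) * (b - a)) \<le> emeasure K {a<..b} \<and>
            emeasure K {a<..b} \<le> ennreal ((r + e/2) * (b - a)))"
      by blast
    have "emeasure K {a<..b} \<le> emeasure K' {a<..b} + ennreal (e * (b - a))"
      if "a \<le> t \<and> t \<le> b \<and> b - a < \<delta>" "K \<in> {M, N}" "K' \<in> {M, N}" for a b K K'
    proof -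
      have "emeasure K {a<..b} \<le> ennreal ((r + e/2) * (b - a))" using b that by blast
      \<comment> \<open>\<open>ennreal\<close> sends negative reals to 0 and is additive only on
        nonnegative ones, so the possibly negative lower bound is clipped before the sum is
        split.\<close>
      also have "\<dots> \<le> ennreal (max 0 ((r - e/2) * (b - a)) + e * (b - a))"
      proof (rule ennreal_leI)
        have "(r + e/2) * (b - a) = (r - e/2) * (b - a) + e * (b - a)" by (simp add: field_simps)
        then show "(r + e/2) * (b - a) \<le> max 0 ((r - e/2) * (b - a)) + e * (b - a)" by simp
      qed
      also have "\<dots> = ennreal ((r - e/2) * (b - a)) + ennreal (e * (b - a))"
      proof -
        have "ennreal (max 0 x) = ennreal x" for x :: real by (auto simp: max_def ennreal_neg)
        then show ?thesis using that e by (subst ennreal_plus) auto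
      qed
      also have "\<dots> \<le> emeasure K' {a<..b} + ennreal (e * (b - a))"
        using b that by (intro add_right_mono) blast
      finally show ?thesis .
    qed
    then show ?case using \<delta> by (intro exI[of _ \<delta>]) auto
  qed
  have eps: "x \<le> y" if "\<And>e. e > 0 \<Longrightarrow> x \<le> y + ennreal (e * (d - c))" for x y :: ennreal
  proof (rule ennreal_le_epsilon)
    fix e :: real assume e: "e > 0"
    \<comment> \<open>The added 1 keeps the denominator positive when \<open>c = d\<close>.\<close>
    have "x \<le> y + ennreal (e / (d - c + 1) * (d - c))" using e cd by (intro that) auto
    also have "\<dots> \<le> y + ennreal e"
      using e cd by (intro add_left_mono ennreal_leI) (auto simp: field_simps)
    finally show "x \<le> y + ennreal e" .
  qed
  show ?thesis
  proof (rule antisym)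
    show "emeasure M {c<..d} \<le> emeasure N {c<..d}" by (rule eps) (use key in blast)
    show "emeasure N {c<..d} \<le> emeasure M {c<..d}" by (rule eps) (use key in blast)
  qed
qed

text \<open>Each exceptional point splits the interval into two open intervals with fewer
  exceptions, which is why the induction leaves \<open>a\<close> and \<open>b\<close> free. Without
  exceptions, the open interval is an increasing union of half-open ones with endpoints strictly
  inside.\<close>

lemma measures_eq_open_interval_finite_exceptions:
  fixes M N :: "real measure"
  assumes M: "sets M = sets borel" and N: "sets N = sets borel" and "finite S"
    and null: "\<And>x. x \<in> S \<Longrightarrow> emeasure M {x} = emeasure N {x}"
    and eq: "\<And>c d. a < c \<Longrightarrow> c \<le> d \<Longrightarrow> d < b \<Longrightarrow> {c..d} \<inter> S = {} \<Longrightarrow>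
               emeasure M {c<..d} = emeasure N {c<..d}"
  shows "emeasure M {a<..<b} = emeasure N {a<..<b}"
  using \<open>finite S\<close> null eq
proof (induction S arbitrary: a b rule: finite_induct)
  case empty
  define I where "I n = {a + 1 / (real n + 1) <.. b - 1 / (real n + 1)}" for n :: nat
  have mono: "incseq I"
  proof (rule incseq_SucI)
    fix n
    have "1 / (real (Suc n) + 1) \<le> 1 / (real n + 1)" by (simp add: frac_le)
    then show "I n \<subseteq> I (Suc n)" by (auto simp: I_def)
  qed
  have un: "(\<Union>n. I n) = {a<..<b}"
  proof safe
    fix x n assume "x \<in> I n"
    moreover have "1 / (real n + 1) > 0" by simp
    ultimately show "x \<in> {a<..<b}"
      unfolding I_def greaterThanLessThan_iff greaterThanAtMost_iff by linarith
  next
    fix x assume "x \<in> {a<..<b}"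
    then have "min (x - a) (b - x) > 0" by simp
    then obtain n where "1 / real (Suc n) < min (x - a) (b - x)" by (rule nat_approx_posE)
    then have "x \<in> I n" by (auto simp: I_def add.commute)
    then show "x \<in> (\<Union>n. I n)" by blast
  qed
  have "emeasure M (I n) = emeasure N (I n)" for n
  proof (cases "a + 1 / (real n + 1) \<le> b - 1 / (real n + 1)")
    case True
    show ?thesis unfolding I_def by (rule empty.prems(2)) (use True in \<open>auto simp: add_pos_nonneg\<close>)
  qed (auto simp: I_def)
  then have eqI: "(SUP n. emeasure M (I n)) = (SUP n. emeasure N (I n))" by simp
  have SUP_I: "(SUP n. emeasure K (I n)) = emeasure K {a<..<b}" if "sets K = sets borel" for K
  proof -
    have "range I \<subseteq> sets K" unfolding that by (auto simp: I_def)
    from SUP_emeasure_incseq[OF this mono] show ?thesis unfolding un .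
  qed
  show ?case using eqI unfolding SUP_I[OF M] SUP_I[OF N] .
next
  case (insert x S)
  show ?case
  proof (cases "x \<in> {a<..<b}")
    case False
    show ?thesis by (rule insert.IH) (use insert.prems False in auto)
  next
    case True
    have 1: "emeasure M {a<..<x} = emeasure N {a<..<x}"
      by (rule insert.IH) (use insert.prems True in auto)
    have 2: "emeasure M {x<..<b} = emeasure N {x<..<b}"
      by (rule insert.IH) (use insert.prems True in auto)
    have 3: "emeasure M {x} = emeasure N {x}" using insert.prems by simp
    have "emeasure K {a<..<b} = emeasure K {a<..<x} + (emeasure K {x} + emeasure K {x<..<b})"
      if "sets K = sets borel" for K
    proof -
      have "{a<..<b} = {a<..<x} \<union> ({x} \<union> {x<..<b})" using True by auto
      then show ?thesis using that by (subst plus_emeasure, simp, simp, force)+ simp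
    qed
    then show ?thesis using M N 1 2 3 by simp
  qed
qed

section \<open>Integer polynomials and their complex roots\<close>

lemma of_int_poly_mult:
  "map_poly of_int (p * q) = map_poly of_int p * (map_poly of_int q :: 'a::comm_ring_1 poly)"
  by (rule poly_eqI) (simp add: coeff_map_poly coeff_mult)

lemma of_int_poly_add:
  "map_poly of_int (p + q) = map_poly of_int p + (map_poly of_int q :: 'a::comm_ring_1 poly)"
  by (rule poly_eqI) (simp add: coeff_map_poly)

lemma of_int_poly_power:
  "map_poly of_int (p ^ n) = (map_poly of_int p :: 'a::comm_ring_1 poly) ^ n"
  by (induction n) (simp_all add: of_int_poly_mult)

lemma of_int_poly_pcompose:
  "map_poly of_int (pcompose p q) = pcompose (map_poly of_int p) (map_poly of_int q :: 'a::comm_ring_1 poly)"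
proof (induction p)
  case (pCons a p)
  have "map_poly of_int [:a:] = [:of_int a :: 'a:]" by (simp add: map_poly_pCons)
  with pCons show ?case
    by (simp add: pcompose_pCons of_int_poly_add of_int_poly_mult map_poly_pCons)
qed simp

lemma of_int_poly_pderiv:
  "map_poly of_int (pderiv p) = (pderiv (map_poly of_int p) :: 'a::{comm_ring_1,ring_no_zero_divisors} poly)"
  by (rule poly_eqI) (simp add: coeff_map_poly coeff_pderiv)

lemma of_rat_of_int_poly:
  "map_poly of_rat (map_poly of_int p) = (map_poly of_int p :: 'a::field_char_0 poly)"
  by (subst map_poly_map_poly) (auto simp: o_def)

lemma degree_of_int_poly [simp]:
  "degree (map_poly of_int p :: 'a::ring_char_0 poly) = degree p"
  by (cases "p = 0") (auto intro: map_poly_degree_eq)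

lemma of_int_poly_eq_0_iff [simp]: "(map_poly of_int p :: 'a::ring_char_0 poly) = 0 \<longleftrightarrow> p = 0"
  by (rule map_poly_eq_0_iff) auto

lemma lead_coeff_of_int_poly [simp]:
  "lead_coeff (map_poly of_int p :: 'a::ring_char_0 poly) = of_int (lead_coeff p)"
  by (simp add: coeff_map_poly)

section \<open>Irreducible integer polynomials as minimal polynomials\<close>

lemma dvd_imp_cpoly_root:
  assumes "P dvd Q" "poly (cpoly P) z = 0" shows "poly (cpoly Q) z = 0"
  using assms by (auto simp: dvd_def of_int_poly_mult)

text \<open>Everything stays in the factorial ring Z[z], where irreducible elements are prime. An
  annihilator \<open>q\<close> of \<alpha> of least degree divides a nonzero constant multiple of
  every annihilator. Applied to \<open>P\<close>, this gives \<open>P dvd q\<close> by primality;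
  applied to \<open>Q\<close>, it gives \<open>P dvd [:c:] * Q\<close>, and \<open>P\<close> cannot
  divide the constant.\<close>

lemma irreducible_int_poly_dvd:
  fixes P Q :: "int poly" and \<alpha> :: complex
  assumes irr: "irreducible P" and P: "poly (cpoly P) \<alpha> = 0" and Q: "poly (cpoly Q) \<alpha> = 0"
  shows "P dvd Q"
proof -
  have P0: "P \<noteq> 0" using irr by auto
  have prime: "prime_elem P" using irr by (rule irreducible_imp_prime_elem)
  define is_ann where "is_ann q \<longleftrightarrow> q \<noteq> 0 \<and> poly (cpoly q) \<alpha> = 0" for q :: "int poly"
  define q where "q = arg_min degree is_ann"
  have annP: "is_ann P" using P0 P by (simp add: is_ann_def)
  have q: "is_ann q" unfolding q_def using annP by (rule arg_min_natI)
  have qmin: "degree q \<le> degree r" if "is_ann r" for r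
    unfolding q_def using that by (rule arg_min_nat_le)
  have deg: "degree p > 0" if ann: "is_ann p" for p
  proof (rule ccontr)
    assume "\<not> 0 < degree p"
    then obtain c where "p = [:c:]" by (metis degree_eq_zeroE gr0I)
    with ann show False by (auto simp: is_ann_def map_poly_pCons)
  qed
  have nconst: "\<not> P dvd [:c:]" if "c \<noteq> 0" for c
    using deg[OF annP] dvd_imp_degree_le[of P "[:c:]"] that by auto
  \<comment> \<open>As \<open>q\<close> may have any leading coefficient, pseudo-division takes the
    place of division; its remainder annihilates \<alpha> and vanishes by minimality.\<close>
  have div: "\<exists>c s. c \<noteq> 0 \<and> smult c R = q * s" if R: "poly (cpoly R) \<alpha> = 0" for R
  proof -
    have q0: "q \<noteq> 0" using q by (simp add: is_ann_def)
    obtain c s where cs: "c \<noteq> 0" "smult c R = q * s + pseudo_mod R q"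
      using pseudo_mod(1)[OF q0, of R] by blast
    have "cpoly (smult c R) = cpoly q * cpoly s + cpoly (pseudo_mod R q)"
      by (simp add: cs(2) of_int_poly_add of_int_poly_mult)
    then have "poly (cpoly (smult c R)) \<alpha> = poly (cpoly (pseudo_mod R q)) \<alpha>"
      using q by (simp add: is_ann_def)
    then have "poly (cpoly (pseudo_mod R q)) \<alpha> = 0"
      using R by (simp add: map_poly_smult)
    then have "pseudo_mod R q = 0"
      using pseudo_mod(2)[OF q0, of R] qmin[of "pseudo_mod R q"] unfolding is_ann_def
      by (meson not_le)
    with cs show ?thesis by auto
  qed
  have Pq: "P dvd q"
  proof -
    obtain c s where cs: "c \<noteq> 0" "smult c P = q * s" using div[OF P] by blast
    have "P dvd q * s" by (metis cs(2) dvd_refl dvd_smult)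
    then consider "P dvd q" | "P dvd s" using prime by (auto simp: prime_elem_dvd_mult_iff)
    then show ?thesis
    proof cases
      \<comment> \<open>Cancelling \<open>P\<close> would make \<open>q\<close> a divisor of a
        nonzero constant, against its positive degree.\<close>
      case 2
      then obtain u where "s = P * u" by (auto simp: dvd_def)
      with cs have "P * [:c:] = P * (q * u)" by (simp add: ac_simps)
      then have e: "[:c:] = q * u" using P0 by (metis mult_left_cancel)
      then have "q dvd [:c:]" by simp
      then have "degree q = 0" using dvd_imp_degree_le[of q "[:c:]"] cs by auto
      with deg[OF q] show ?thesis by simp
    qed
  qed
  obtain c s where cs: "c \<noteq> 0" "smult c Q = q * s" using div[OF Q] by blast
  have "P dvd [:c:] * Q" using Pq cs(2) by (simp add: dvd_mult2)
  then show ?thesis using prime_elem_dvd_multD[OF prime] nconst[OF cs(1)] by blast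
qed

text \<open>The degree is minimized among monic annihilators only. In a factorization both factors
  have leading coefficient 1 or both have -1, so up to sign the factor vanishing at \<alpha>
  competes in the minimization, and the other factor must be constant.\<close>

lemma irreducible_monic_int_poly_exists:
  fixes \<alpha> :: complex
  assumes "algebraic_int \<alpha>"
  obtains P :: "int poly" where "irreducible P" "lead_coeff P = 1" "poly (cpoly P) \<alpha> = 0"
proof -
  define is_ann where "is_ann q \<longleftrightarrow> lead_coeff q = 1 \<and> poly (cpoly q) \<alpha> = 0" for q :: "int poly"
  obtain A where A: "is_ann A"
    using assms unfolding algebraic_int_altdef_ipoly is_ann_def by blast
  define P where "P = arg_min degree is_ann"
  have P: "is_ann P" unfolding P_def using A by (rule arg_min_natI)
  have Pmin: "degree P \<le> degree r" if "is_ann r" for r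
    unfolding P_def using that by (rule arg_min_nat_le)
  have P0: "P \<noteq> 0" using P by (auto simp: is_ann_def)
  have unit: "is_unit R"
    if QR: "P = Q * R" and Q: "poly (cpoly Q) \<alpha> = 0" for Q R
  proof -
    have lc: "lead_coeff Q * lead_coeff R = 1"
      using P unfolding QR is_ann_def by (simp add: lead_coeff_mult)
    then have l: "lead_coeff Q = 1 \<and> lead_coeff R = 1 \<or> lead_coeff Q = -1 \<and> lead_coeff R = -1"
      by (simp add: zmult_eq_1_iff)
    have "cpoly (smult (lead_coeff Q) Q) = smult (of_int (lead_coeff Q)) (cpoly Q)"
      by (simp add: map_poly_smult)
    then have "is_ann (smult (lead_coeff Q) Q)"
      using l Q unfolding is_ann_def by (auto simp: lead_coeff_smult)
    then have "degree P \<le> degree Q" using Pmin by (metis degree_smult_le order_trans)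
    moreover have "degree P = degree Q + degree R"
      unfolding QR using P0 QR by (intro degree_mult_eq) auto
    ultimately have "degree R = 0" by simp
    then obtain c where "R = [:c:]" by (rule degree_eq_zeroE)
    with l show ?thesis by (auto simp: is_unit_const_poly_iff)
  qed
  have "irreducible P"
  proof (rule irreducibleI)
    show "\<not> is_unit P"
    proof
      assume "is_unit P"
      then have "P dvd 1" .
      moreover have "poly (cpoly P) \<alpha> = 0" using P by (simp add: is_ann_def)
      ultimately have "poly (cpoly (1::int poly)) \<alpha> = 0" by (rule dvd_imp_cpoly_root)
      then show False by simp
    qed
    fix Q R assume QR: "P = Q * R"
    have "poly (cpoly Q) \<alpha> = 0 \<or> poly (cpoly R) \<alpha> = 0"
      using P by (auto simp: QR is_ann_def of_int_poly_mult)
    then show "is_unit Q \<or> is_unit R"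
    proof
      assume "poly (cpoly R) \<alpha> = 0"
      then show ?thesis using unit[of R Q] QR by (simp only: mult.commute simp_thms)
    qed (use unit[OF QR] in blast)
  qed (rule P0)
  then show ?thesis using that P by (auto simp: is_ann_def)
qed

lemma clear_denominators:
  fixes q :: "rat poly"
  shows "\<exists>c r. c \<noteq> 0 \<and> smult (of_int c) q = map_poly of_int (r :: int poly)"
proof (induction q)
  case 0
  show ?case by (rule exI[of _ 1], rule exI[of _ 0]) simp
next
  case (pCons a q)
  then obtain c r where cr: "c \<noteq> 0" "smult (of_int c) q = map_poly of_int r" by blast
  obtain i j where ij: "quotient_of a = (i, j)" by (cases "quotient_of a")
  then have a: "a = of_int i / of_int j" "j \<noteq> 0"
    using quotient_of_div quotient_of_denom_pos by (blast, fastforce)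
  have "smult (of_int (j * c)) (pCons a q) = pCons (of_int (i * c)) (smult (of_int j) (map_poly of_int r))"
    using a by (simp flip: cr(2))
  also have "\<dots> = map_poly of_int (pCons (i * c) (smult j r))"
    by (simp add: map_poly_pCons map_poly_smult)
  finally show ?case using a cr by (metis mult_eq_0_iff)
qed

text \<open>The link to \<open>conjugates\<close> and \<open>cyclotomic\<close>, which refer to
  rational polynomials: after clearing denominators a rational annihilator is an integer one, hence
  a multiple of \<open>P\<close>.\<close>

lemma irreducible_imp_is_min_poly:
  fixes P :: "int poly"
  assumes "irreducible P" "lead_coeff P = 1" "poly (cpoly P) \<alpha> = 0"
  shows "is_min_poly \<alpha> (map_poly of_int P)"
  unfolding is_min_poly_def
proof (intro conjI allI impI)
  fix q :: "rat poly" assume q: "q \<noteq> 0 \<and> poly (map_poly of_rat q) \<alpha> = 0"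
  obtain c r where cr: "c \<noteq> 0" "smult (of_int c) q = map_poly of_int (r :: int poly)"
    using clear_denominators by blast
  have "map_poly of_rat (smult (of_int c) q) = cpoly r"
    unfolding cr(2) by (rule of_rat_of_int_poly)
  then have "smult (of_int c) (map_poly of_rat q) = cpoly r"
    by (subst (asm) map_poly_smult) (auto simp: of_rat_mult)
  then have "poly (cpoly r) \<alpha> = 0"
    using q by (metis mult_zero_right poly_smult)
  then have dvd: "P dvd r" using assms by (intro irreducible_int_poly_dvd[of P \<alpha>])
  have "degree (map_poly of_int r :: rat poly) = degree q" "r \<noteq> 0"
    using cr q by (metis degree_smult_eq of_int_eq_0_iff)
                  (metis cr(1) cr(2) q map_poly_0 of_int_eq_0_iff smult_eq_0_iff)
  then show "degree (map_poly of_int P :: rat poly) \<le> degree q"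
    using dvd_imp_degree_le[OF dvd] by simp
qed (use assms in \<open>auto simp: of_rat_of_int_poly coeff_map_poly\<close>)

text \<open>The minimal polynomial of a root of unity divides \<open>z ^ n - 1\<close>, because the
  remainder has smaller degree and vanishes at \<open>\<zeta>\<close>. So all its roots are
  \<open>n\<close>-th roots of unity.\<close>

lemma cyclotomic_root_of_unity:
  assumes "cyclotomic \<Phi>" "poly (cpoly \<Phi>) x = 0"
  shows "cmod x = 1"
proof -
  obtain \<zeta> n where n: "n > 0" "\<zeta> ^ n = 1" and mp: "is_min_poly \<zeta> (map_poly of_int \<Phi>)"
    using assms by (auto simp: cyclotomic_def)
  define \<Psi> :: "rat poly" where "\<Psi> = map_poly of_int \<Phi>"
  define W :: "rat poly" where "W = monom 1 n - 1"
  have hom_mult: "map_poly of_rat (p * q) = map_poly of_rat p * (map_poly of_rat q :: complex poly)" for p q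
    by (rule poly_eqI) (simp add: coeff_map_poly coeff_mult of_rat_sum of_rat_mult)
  have hom_add: "map_poly of_rat (p + q) = map_poly of_rat p + (map_poly of_rat q :: complex poly)" for p q
    by (rule poly_eqI) (simp add: coeff_map_poly of_rat_add)
  have W': "map_poly of_rat W = (monom 1 n - 1 :: complex poly)"
    by (rule poly_eqI) (simp add: coeff_map_poly W_def of_rat_diff)
  have eq: "map_poly of_rat W =
      map_poly of_rat (W div \<Psi>) * map_poly of_rat \<Psi> + (map_poly of_rat (W mod \<Psi>) :: complex poly)"
    by (simp flip: hom_mult hom_add)
  have z: "poly (map_poly of_rat \<Psi>) \<zeta> = 0" and lc: "lead_coeff \<Psi> = 1"
    and min: "\<And>q. q \<noteq> 0 \<Longrightarrow> poly (map_poly of_rat q) \<zeta> = 0 \<Longrightarrow> degree \<Psi> \<le> degree q"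
    using mp by (auto simp: is_min_poly_def \<Psi>_def)
  have "poly (map_poly of_rat (W mod \<Psi>)) \<zeta> = 0"
    using arg_cong[OF eq, of "\<lambda>p. poly p \<zeta>"] z n by (simp add: W' poly_monom)
  moreover have "\<Psi> \<noteq> 0" using lc by auto
  ultimately have "W mod \<Psi> = 0"
    using min[of "W mod \<Psi>"] degree_mod_less[of \<Psi> W] by (meson not_le)
  moreover have "poly (map_poly of_rat \<Psi>) x = 0"
    using assms(2) by (simp add: \<Psi>_def of_rat_of_int_poly)
  ultimately have "x ^ n = 1"
    using arg_cong[OF eq, of "\<lambda>p. poly p x"] by (simp add: W' poly_monom)
  then show ?thesis using n by (metis norm_one norm_power power_eq_1_iff norm_ge_zero power_eq_imp_eq_base power_one)
qed

lemma cyclotomic_exists: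
  assumes "n > 0" "\<zeta> ^ n = (1::complex)"
  obtains \<Phi> where "cyclotomic \<Phi>" "poly (cpoly \<Phi>) \<zeta> = 0"
proof -
  have "algebraic_int \<zeta>"
    unfolding algebraic_int_altdef_ipoly
  proof (intro exI[of _ "monom 1 n - 1 :: int poly"] conjI)
    have "cpoly (monom 1 n - 1) = monom 1 n - 1"
      by (rule poly_eqI) (simp add: coeff_map_poly)
    then show "poly (cpoly (monom 1 n - 1)) \<zeta> = 0" using assms by (simp add: poly_monom)
    have "degree (monom 1 n - 1 :: int poly) = n"
      using degree_add_eq_left[of "- 1" "monom 1 n :: int poly"] assms(1) by (simp add: degree_monom_eq)
    then show "lead_coeff (monom 1 n - 1 :: int poly) = 1" using assms(1) by simp
  qed
  then obtain P where P: "irreducible P" "lead_coeff P = 1" "poly (cpoly P) \<zeta> = 0"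
    by (rule irreducible_monic_int_poly_exists)
  from irreducible_imp_is_min_poly[OF this] assms have "cyclotomic P"
    by (auto simp: cyclotomic_def)
  with P show ?thesis using that by blast
qed

section \<open>Simple roots and Kronecker's theorem\<close>

lemma rsquarefree_card_roots:
  fixes p :: "complex poly"
  assumes "rsquarefree p"
  shows "card {z. poly p z = 0} = degree p"
proof -
  have p0: "p \<noteq> 0" using assms by (auto simp: rsquarefree_def)
  have "degree p = degree (\<Prod>z|poly p z = 0. [:-z, 1:])"
    by (subst (1) complex_poly_decompose_rsquarefree[OF assms, symmetric]) (use p0 in simp)
  also have "\<dots> = card {z. poly p z = 0}"
    by (subst degree_prod_sum_eq) auto
  finally show ?thesis by simp
qed

lemma irreducible_monic_int_poly_degree:
  fixes P :: "int poly"
  assumes "irreducible P" "lead_coeff P = 1"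
  shows "degree P > 0"
proof (rule ccontr)
  assume "\<not> degree P > 0"
  then have "P = 1" using assms(2) by (metis degree_eq_zeroE gr0I lead_coeff_pCons(2) one_pCons)
  then show False using assms(1) by simp
qed

text \<open>At a multiple root the derivative vanishes too, so \<open>P\<close> would divide
  \<open>pderiv P\<close>, which is nonzero and of smaller degree.\<close>

lemma irreducible_imp_rsquarefree_cpoly:
  fixes P :: "int poly"
  assumes irr: "irreducible P" and lc: "lead_coeff P = 1"
  shows "rsquarefree (cpoly P)"
  unfolding rsquarefree_roots
proof safe
  fix a assume a: "poly (cpoly P) a = 0" "poly (pderiv (cpoly P)) a = 0"
  then have dvd: "P dvd pderiv P"
    by (intro irreducible_int_poly_dvd[OF irr a(1)]) (simp add: of_int_poly_pderiv)
  have "degree P \<noteq> 0" using irreducible_monic_int_poly_degree[OF irr lc] by simp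
  moreover have "pderiv P \<noteq> 0" using calculation by (simp add: pderiv_eq_0_iff)
  ultimately show False
    using dvd_imp_degree_le[OF dvd] by (simp add: degree_pderiv)
qed

text \<open>Lagrange interpolation: the coefficients depend linearly on the values at the nodes, so
  the bound \<open>C\<close> depends on \<open>S\<close> alone. The \<open>l a\<close> in the proof
  are the Lagrange basis polynomials.\<close>

lemma coeff_bounded_by_values:
  fixes S :: "complex set"
  assumes "finite S"
  obtains C where "\<And>r i. degree r < card S \<Longrightarrow> (\<And>x. x \<in> S \<Longrightarrow> cmod (poly r x) \<le> 1) \<Longrightarrow> cmod (coeff r i) \<le> C"
proof -
  define l where "l a = (\<Prod>b\<in>S-{a}. smult (1 / (a - b)) [:-b, 1:])" for a
  have deg_l: "degree (l a) < card S" if "a \<in> S" for a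
  proof -
    have "degree (l a) \<le> (\<Sum>b\<in>S-{a}. degree (smult (1 / (a - b)) [:-b, 1:]))"
      unfolding l_def using degree_prod_sum_le[of "S - {a}" "\<lambda>b. smult (1 / (a - b)) [:-b, 1:]"] assms
      by (simp add: o_def del: smult_pCons)
    also have "\<dots> \<le> (\<Sum>b\<in>S-{a}. 1)"
      by (intro sum_mono degree_smult_le[THEN order_trans]) simp
    also have "\<dots> < card S" using card_gt_0_iff[of S] that assms by auto
    finally show ?thesis .
  qed
  have val_l: "poly (l a) x = (if x = a then 1 else 0)" if "a \<in> S" "x \<in> S" for a x
  proof (cases "x = a")
    case True
    then show ?thesis unfolding l_def poly_prod
      by (auto intro!: prod.neutral simp: diff_divide_distrib[symmetric] split: if_splits)
  next
    case False
    then show ?thesis using that assms unfolding l_def poly_prod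
      by (auto intro!: prod_zero bexI[of _ x])
  qed
  define C where "C = (\<Sum>a\<in>S. \<Sum>i\<le>degree (l a). cmod (coeff (l a) i))"
  have coeff_l: "cmod (coeff (l a) i) \<le> (\<Sum>i\<le>degree (l a). cmod (coeff (l a) i))" for a i
    by (cases "i \<le> degree (l a)")
       (auto intro: member_le_sum sum_nonneg simp: coeff_eq_0)
  show ?thesis
  proof (rule that[of C])
    fix r i assume r: "degree r < card S" and b: "\<And>x. x \<in> S \<Longrightarrow> cmod (poly r x) \<le> 1"
    have "r = (\<Sum>a\<in>S. smult (poly r a) (l a))"
    proof (rule poly_eqI_degree[of S])
      fix x assume x: "x \<in> S"
      have "poly (\<Sum>a\<in>S. smult (poly r a) (l a)) x = (\<Sum>a\<in>S. if x = a then poly r a else 0)"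
        unfolding poly_sum by (intro sum.cong) (auto simp: val_l x)
      then show "poly r x = poly (\<Sum>a\<in>S. smult (poly r a) (l a)) x"
        using x assms by simp
    next
      have "card S > 0" using r by simp
      then have "degree (\<Sum>a\<in>S. smult (poly r a) (l a)) \<le> card S - 1"
        using deg_l by (intro degree_sum_le assms) (force intro!: degree_smult_le[THEN order_trans])+
      then show "degree (\<Sum>a\<in>S. smult (poly r a) (l a)) < card S" using r by simp
    qed (rule r)
    then have "coeff r i = (\<Sum>a\<in>S. poly r a * coeff (l a) i)"
      by (metis (no_types, lifting) coeff_smult coeff_sum sum.cong)
    then have "cmod (coeff r i) \<le> (\<Sum>a\<in>S. cmod (poly r a) * cmod (coeff (l a) i))"
      by (simp add: sum_norm_le norm_mult)
    also have "\<dots> \<le> (\<Sum>a\<in>S. 1 * (\<Sum>i\<le>degree (l a). cmod (coeff (l a) i)))"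
      by (intro sum_mono mult_mono b coeff_l) (auto intro: sum_nonneg)
    finally show "cmod (coeff r i) \<le> C" by (simp add: C_def)
  qed
qed

lemma finite_bounded_int_polys: "finite {r :: int poly. degree r < d \<and> (\<forall>i. \<bar>coeff r i\<bar> \<le> N)}"
proof (rule finite_subset)
  show "{r :: int poly. degree r < d \<and> (\<forall>i. \<bar>coeff r i\<bar> \<le> N)}
          \<subseteq> Poly ` {xs. set xs \<subseteq> {-N..N} \<and> length xs \<le> d}"
  proof safe
    fix r :: "int poly" assume r: "degree r < d" "\<forall>i. \<bar>coeff r i\<bar> \<le> N"
    have "set (coeffs r) \<subseteq> {-N..N}"
    proof
      fix x assume "x \<in> set (coeffs r)"
      then obtain i where "x = coeff r i" by (auto simp: coeffs_def split: if_splits)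
      then show "x \<in> {-N..N}" using r(2) by (simp add: abs_le_iff) (metis abs_le_D1 abs_le_D2 minus_le_iff)
    qed
    moreover have "length (coeffs r) \<le> d"
      using r(1) by (cases "r = 0") (auto simp: length_coeffs_degree)
    ultimately show "r \<in> Poly ` {xs. set xs \<subseteq> {-N..N} \<and> length xs \<le> d}"
      by (intro image_eqI[of _ _ "coeffs r"]) auto
  qed
  show "finite (Poly ` {xs. set xs \<subseteq> {-N..N} \<and> length xs \<le> d})"
    by (intro finite_imageI finite_lists_length_le) simp
qed

text \<open>
  Kronecker's theorem for \<open>V(\<alpha>)\<close>, where \<open>\<alpha>\<close> runs through the roots of \<open>P\<close>: the remainders of
  \<open>V ^ k\<close> modulo \<open>P\<close> have bounded values at these roots, hence bounded integer coefficients,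
  so two of them coincide.
\<close>

lemma kronecker_dvd:
  fixes P V :: "int poly"
  assumes irr: "irreducible P" and lc: "lead_coeff P = 1"
    and bd: "\<And>z. poly (cpoly P) z = 0 \<Longrightarrow> cmod (poly (cpoly V) z) \<le> 1"
  shows "P dvd V \<or> (\<exists>n>0. P dvd V ^ n - 1)"
proof -
  have P0: "P \<noteq> 0" using irr by auto
  have prime: "prime_elem P" using irr by (rule irreducible_imp_prime_elem)
  define S where "S = {z. poly (cpoly P) z = 0}"
  \<comment> \<open>The roots are simple, so there are enough nodes for interpolating every
    remainder modulo \<open>P\<close>.\<close>
  have S: "finite S" "card S = degree P"
    using rsquarefree_card_roots[OF irreducible_imp_rsquarefree_cpoly[OF irr lc]] P0
    by (auto simp: S_def intro!: poly_roots_finite)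
  \<comment> \<open>For monic \<open>P\<close> the scaling factor of pseudo-division is 1, so this
    is a genuine remainder.\<close>
  define rm where "rm k = snd (pseudo_divmod (V ^ k) P)" for k
  have rm: "V ^ k = P * fst (pseudo_divmod (V ^ k) P) + rm k" "rm k = 0 \<or> degree (rm k) < degree P" for k
    using pseudo_divmod[OF P0 prod.collapse[symmetric], of "V ^ k"] lc by (auto simp: rm_def)
  have degP: "degree P > 0" by (rule irreducible_monic_int_poly_degree[OF irr lc])
  have deg: "degree (rm k) < degree P" for k using rm(2)[of k] degP by auto
  have val: "poly (cpoly (rm k)) x = poly (cpoly V) x ^ k" if "x \<in> S" for k x
  proof -
    have "cpoly (V ^ k) = cpoly P * cpoly (fst (pseudo_divmod (V ^ k) P)) + cpoly (rm k)"
      by (subst rm(1)) (simp add: of_int_poly_add of_int_poly_mult)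
    from arg_cong[OF this, of "\<lambda>p. poly p x"] show ?thesis
      using that by (simp add: S_def of_int_poly_power)
  qed
  obtain C where C: "\<And>r i. degree r < card S \<Longrightarrow> (\<And>x. x \<in> S \<Longrightarrow> cmod (poly r x) \<le> 1) \<Longrightarrow> cmod (coeff r i) \<le> C"
    using coeff_bounded_by_values[OF S(1)] by blast
  have "\<bar>coeff (rm k) i\<bar> \<le> \<lfloor>C\<rfloor>" for k i
  proof -
    have "cmod (coeff (cpoly (rm k)) i) \<le> C"
    proof (rule C)
      show "degree (cpoly (rm k)) < card S" using deg S by simp
      show "cmod (poly (cpoly (rm k)) x) \<le> 1" if "x \<in> S" for x
        using bd[of x] that by (simp add: val norm_power power_le_one S_def)
    qed
    then show ?thesis by (simp add: coeff_map_poly le_floor_iff)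
  qed
  then have "range rm \<subseteq> {r. degree r < degree P \<and> (\<forall>i. \<bar>coeff r i\<bar> \<le> \<lfloor>C\<rfloor>)}"
    using deg by auto
  then have "finite (range rm)" using finite_bounded_int_polys finite_subset by blast
  then have "\<not> inj rm" using finite_imageD infinite_UNIV_nat by blast
  then obtain i j where ij: "i < j" "rm i = rm j"
    unfolding inj_def by (metis linorder_neqE_nat)
  have "V ^ j - V ^ i = P * (fst (pseudo_divmod (V ^ j) P) - fst (pseudo_divmod (V ^ i) P))"
    by (subst (1) rm(1), subst (2) rm(1)) (simp add: ij algebra_simps)
  then have "P dvd V ^ j - V ^ i" by simp
  \<comment> \<open>Since \<open>P\<close> is prime it divides one factor: the first leads to
    \<open>P dvd V\<close>, the second to the exponent \<open>j - i\<close>.\<close>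
  also have "V ^ j - V ^ i = V ^ i * (V ^ (j - i) - 1)"
    using ij by (simp add: algebra_simps flip: power_add)
  finally have "P dvd V ^ i \<or> P dvd V ^ (j - i) - 1"
    using prime by (simp add: prime_elem_dvd_mult_iff)
  then show ?thesis
    using ij prime_elem_dvd_power[OF prime] by (metis zero_less_diff)
qed

text \<open>If \<open>P dvd V ^ n - 1\<close>, the value of \<open>V\<close> at any one root
  \<open>z\<close> of \<open>P\<close> is a root of unity. With \<open>\<Phi>\<close> its minimal
  polynomial, \<open>\<Phi> \<circ> V\<close> vanishes at \<open>z\<close>, so irreducibility gives
  the divisibility. Conversely, \<open>V\<close> takes at the roots of \<open>P\<close> only the
  value 0 or values of modulus 1.\<close>

lemma irreducible_dvd_iff_roots_in_filled_lemniscate: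
  fixes P V :: "int poly"
  assumes irr: "irreducible P" and lc: "lead_coeff P = 1"
  shows "(\<forall>z. poly (cpoly P) z = 0 \<longrightarrow> z \<in> filled_lemniscate V) \<longleftrightarrow>
           P dvd V \<or> (\<exists>\<Phi>. cyclotomic \<Phi> \<and> P dvd pcompose \<Phi> V)" (is "?lhs \<longleftrightarrow> ?rhs")
proof
  assume ?lhs
  then consider "P dvd V" | n where "n > 0" "P dvd V ^ n - 1"
    using kronecker_dvd[OF irr lc, of V] by (auto simp: filled_lemniscate_def)
  then show ?rhs
  proof cases
    case 2
    have "degree (cpoly P) \<noteq> 0" using irreducible_monic_int_poly_degree[OF irr lc] by simp
    then have "\<not> constant (poly (cpoly P))" by (subst constant_degree)
    then obtain z where z: "poly (cpoly P) z = 0" using fundamental_theorem_of_algebra by blast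
    have "poly (cpoly (V ^ n - 1)) z = 0" using dvd_imp_cpoly_root[OF 2(2) z] .
    moreover have "cpoly (V ^ n - 1) = cpoly V ^ n - 1"
      using of_int_poly_add[of "V ^ n - 1" 1, where 'a = complex] by (simp add: of_int_poly_power)
    ultimately have "poly (cpoly V) z ^ n = 1" by simp
    then obtain \<Phi> where \<Phi>: "cyclotomic \<Phi>" "poly (cpoly \<Phi>) (poly (cpoly V) z) = 0"
      using cyclotomic_exists 2(1) by blast
    then have "P dvd pcompose \<Phi> V"
      by (intro irreducible_int_poly_dvd[OF irr z]) (simp add: of_int_poly_pcompose poly_pcompose)
    with \<Phi> show ?thesis by blast
  qed simp
next
  assume ?rhs
  then show ?lhs
  proof (elim disjE exE conjE; intro allI impI)
    fix z assume "P dvd V" "poly (cpoly P) z = 0"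
    then show "z \<in> filled_lemniscate V" by (auto simp: filled_lemniscate_def dest: dvd_imp_cpoly_root)
  next
    fix \<Phi> z assume "cyclotomic \<Phi>" "P dvd pcompose \<Phi> V" "poly (cpoly P) z = 0"
    then have "cmod (poly (cpoly V) z) = 1"
      using dvd_imp_cpoly_root[of P "pcompose \<Phi> V" z]
      by (intro cyclotomic_root_of_unity[of \<Phi>]) (simp_all add: of_int_poly_pcompose poly_pcompose)
    then show "z \<in> filled_lemniscate V" by (simp add: filled_lemniscate_def)
  qed
qed

section \<open>Arc length along a lemniscate\<close>

lemma cmod_cis_diff: "cmod (cis s - cis t) = 2 * \<bar>sin ((s - t) / 2)\<bar>"
proof -
  have "cis s - cis t = cis t * (exp (\<i> * of_real (s - t)) - 1)"
    by (simp only: cis_conv_exp[symmetric] right_diff_distrib cis_mult) simp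
  then show ?thesis by (simp only: norm_mult norm_cis dist_exp_i_1)
qed

lemma cmod_cis_diff_le: "cmod (cis s - cis t) \<le> \<bar>s - t\<bar>"
  using abs_sin_x_le_abs_x[of "(s - t) / 2"] by (simp add: cmod_cis_diff)

lemma cmod_cis_diff_ge:
  assumes "\<eta> > 0"
  obtains R where "R > 0" "\<And>s t. \<bar>s - t\<bar> < R \<Longrightarrow> (1 - \<eta>) * \<bar>s - t\<bar> \<le> cmod (cis s - cis t)"
proof -
  have "((\<lambda>h. sin h / h) \<longlongrightarrow> 1) (at (0::real))"
    using DERIV_sin[of "0::real"] by (simp add: DERIV_def)
  then have "eventually (\<lambda>h. 1 - \<eta> < sin h / h) (at (0::real))"
    using assms by (intro order_tendstoD) auto
  then obtain R where R: "R > 0" "\<And>h. h \<noteq> 0 \<Longrightarrow> \<bar>h\<bar> < R \<Longrightarrow> 1 - \<eta> < sin h / h"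
    by (auto simp: eventually_at dist_real_def)
  show ?thesis
  proof (rule that[of R])
    fix s t :: real assume st: "\<bar>s - t\<bar> < R"
    define h where "h = (s - t) / 2"
    have "(1 - \<eta>) * \<bar>h\<bar> \<le> \<bar>sin h\<bar>"
    proof (cases "h = 0")
      case False
      have "1 - \<eta> < sin h / h" by (rule R(2)) (use False st in \<open>auto simp: h_def\<close>)
      also have "\<dots> \<le> \<bar>sin h\<bar> / \<bar>h\<bar>" by (metis abs_divide abs_ge_self)
      finally show ?thesis using False by (simp add: field_simps)
    qed simp
    then show "(1 - \<eta>) * \<bar>s - t\<bar> \<le> cmod (cis s - cis t)"
      by (simp add: cmod_cis_diff h_def)
  qed (rule R)
qed

text \<open>Strict differentiability, with both points free: this yields two-sided Lipschitz bounds
  for \<open>p\<close> near \<open>z\<close>. It is the mean value inequality for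
  \<open>p x - p' z * x\<close>, whose derivative is small near \<open>z\<close>.\<close>

lemma poly_strict_derivative:
  fixes p :: "complex poly"
  assumes "\<eta> > 0"
  obtains R where "R > 0" "\<And>x y. x \<in> ball z R \<Longrightarrow> y \<in> ball z R \<Longrightarrow>
    cmod (poly p x - poly p y - poly (pderiv p) z * (x - y)) \<le> \<eta> * cmod (x - y)"
proof -
  have "isCont (poly (pderiv p)) z" by simp
  then obtain R where R: "R > 0" "\<And>x. dist x z < R \<Longrightarrow> dist (poly (pderiv p) x) (poly (pderiv p) z) < \<eta>"
    using assms unfolding continuous_at_eps_delta by blast
  show ?thesis
  proof (rule that[OF R(1)])
    fix x y assume xy: "x \<in> ball z R" "y \<in> ball z R"
    have "cmod ((poly p x - poly (pderiv p) z * x) - (poly p y - poly (pderiv p) z * y)) \<le> \<eta> * cmod (x - y)"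
    proof (rule field_differentiable_bound[OF convex_ball _ _ xy])
      fix w assume w: "w \<in> ball z R"
      show "((\<lambda>x. poly p x - poly (pderiv p) z * x) has_field_derivative
              poly (pderiv p) w - poly (pderiv p) z) (at w within ball z R)"
        by (auto intro!: derivative_eq_intros poly_DERIV[THEN DERIV_subset])
      show "cmod (poly (pderiv p) w - poly (pderiv p) z) \<le> \<eta>"
        using R(2)[of w] w by (simp add: dist_norm norm_minus_commute)
    qed
    then show "cmod (poly p x - poly p y - poly (pderiv p) z * (x - y)) \<le> \<eta> * cmod (x - y)"
      by (simp add: algebra_simps)
  qed
qed

lemma cis_interval_borel: "cis ` {a<..b} \<in> sets borel"
proof -
  have "{a<..b} = (\<Union>n. {a + 1 / real (Suc n)..b})"
  proof (intro equalityI subsetI)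
    fix x assume x: "x \<in> {a<..b}"
    then have "x - a > 0" by simp
    then obtain n where "1 / real (Suc n) < x - a" by (rule nat_approx_posE)
    then show "x \<in> (\<Union>n. {a + 1 / real (Suc n)..b})" using x by (auto intro!: exI[of _ n])
  next
    fix x assume "x \<in> (\<Union>n. {a + 1 / real (Suc n)..b})"
    then obtain n where n: "a + 1 / real (Suc n) \<le> x" "x \<le> b" by auto
    have "1 / real (Suc n) > 0" by simp
    then show "x \<in> {a<..b}" using n unfolding greaterThanAtMost_iff by linarith
  qed
  then have "cis ` {a<..b} = (\<Union>n. cis ` {a + 1 / real (Suc n)..b})" by blast
  moreover have "cis ` {c..d} \<in> sets borel" for c d
    by (intro borel_compact compact_continuous_image continuous_intros) auto
  ultimately show ?thesis by auto
qed

text \<open>Near \<open>z0\<close>, \<open>p\<close> scales distances by factors between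
  \<open>q - \<eta>\<close> and \<open>q + \<eta>\<close>, and chords of the circle have between
  \<open>1 - \<eta>\<close> and 1 times the length of the angle. Hence the Hausdorff measure of
  \<open>A\<close> is about \<open>(b - a) / q\<close>. The integrand is within
  \<open>\<eta>\<close> of \<open>f z0 * q\<close> on \<open>A\<close>, and the factor
  \<open>q\<close> cancels.\<close>

lemma arc_piece_estimate:
  fixes p :: "complex poly" and f :: "complex \<Rightarrow> real"
  assumes p'0: "poly (pderiv p) z0 \<noteq> 0" and f0: "f z0 \<ge> 0" and cont: "isCont f z0" and e: "e > 0"
  obtains R where "R > 0" "inj_on (poly p) (ball z0 R)"
    and "\<And>x. x \<in> ball z0 R \<Longrightarrow> \<bar>f x - f z0\<bar> < e"
    and "\<And>A a b. A \<in> sets borel \<Longrightarrow> A \<subseteq> ball z0 R \<Longrightarrow> a \<le> b \<Longrightarrow> b - a < R \<Longrightarrow>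
      poly p ` A = cis ` {a<..b} \<Longrightarrow>
      ennreal ((f z0 - e) * (b - a))
        \<le> (\<integral>\<^sup>+z. ennreal (f z * cmod (poly (pderiv p) z)) * indicator A z \<partial>arc_length) \<and>
      (\<integral>\<^sup>+z. ennreal (f z * cmod (poly (pderiv p) z)) * indicator A z \<partial>arc_length)
        \<le> ennreal ((f z0 + e) * (b - a))"
proof -
  define q where "q = cmod (poly (pderiv p) z0)"
  define \<phi> where "\<phi> = f z0"
  have q: "q > 0" and \<phi>: "\<phi> \<ge> 0" using p'0 f0 by (auto simp: q_def \<phi>_def)
  \<comment> \<open>This quotient and the one in \<open>lim2\<close> are the slopes in the final
    upper and lower estimates. Both tend to \<open>\<phi>\<close>, which determines how small
    \<open>\<eta>\<close> has to be.\<close>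
  have lim1: "((\<lambda>\<eta>. (\<phi> * q + \<eta>) / (q - \<eta>)) \<longlongrightarrow> (\<phi> * q + 0) / (q - 0)) (at_right 0)"
    using q by (intro tendsto_intros) auto
  have lim2: "((\<lambda>\<eta>. (\<phi> * q - \<eta>) * ((1 - \<eta>) / (q + \<eta>))) \<longlongrightarrow> (\<phi> * q - 0) * ((1 - 0) / (q + 0))) (at_right 0)"
    using q by (intro tendsto_intros) auto
  have "eventually (\<lambda>\<eta>. (\<phi> * q + \<eta>) / (q - \<eta>) < \<phi> + e \<and>
          \<phi> - e < (\<phi> * q - \<eta>) * ((1 - \<eta>) / (q + \<eta>)) \<and> 0 < \<eta> \<and> \<eta> < min q 1) (at_right 0)"
    using q e order_tendstoD(2)[OF lim1, of "\<phi> + e"] order_tendstoD(1)[OF lim2, of "\<phi> - e"]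
    by (intro eventually_conj) (auto simp: eventually_at_right_less eventually_at_right_real
        intro: eventually_at_right_less eventually_mono[OF eventually_at_right_real[of 0 "min q 1"]])
  then obtain \<eta> where \<eta>: "(\<phi> * q + \<eta>) / (q - \<eta>) < \<phi> + e"
      "\<phi> - e < (\<phi> * q - \<eta>) * ((1 - \<eta>) / (q + \<eta>))" "0 < \<eta>" "\<eta> < q" "\<eta> < 1"
    using eventually_happens'[OF trivial_limit_at_right_real] by force
  obtain R1 where R1: "R1 > 0" "\<And>s t. \<bar>s - t\<bar> < R1 \<Longrightarrow> (1 - \<eta>) * \<bar>s - t\<bar> \<le> cmod (cis s - cis t)"
    using cmod_cis_diff_ge[OF \<eta>(3)] by blast
  obtain R2 where R2: "R2 > 0" "\<And>x y. x \<in> ball z0 R2 \<Longrightarrow> y \<in> ball z0 R2 \<Longrightarrow>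
      cmod (poly p x - poly p y - poly (pderiv p) z0 * (x - y)) \<le> \<eta> * cmod (x - y)"
    using poly_strict_derivative[OF \<eta>(3)] by blast
  have "isCont (\<lambda>z. f z * cmod (poly (pderiv p) z)) z0"
    using cont by (intro continuous_intros) auto
  then obtain R3 where R3: "R3 > 0" "\<And>x. dist x z0 < R3 \<Longrightarrow>
      dist (f x * cmod (poly (pderiv p) x)) (f z0 * cmod (poly (pderiv p) z0)) < \<eta>"
    using \<eta>(3) unfolding continuous_at_eps_delta by blast
  obtain R4 where R4: "R4 > 0" "\<And>x. dist x z0 < R4 \<Longrightarrow> dist (f x) (f z0) < e"
    using e cont unfolding continuous_at_eps_delta by blast
  define R where "R = min (min R1 R2) (min R3 R4)"
  have R: "R > 0" using R1 R2 R3 R4 by (simp add: R_def)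
  have up: "cmod (poly p x - poly p y) \<le> (q + \<eta>) * cmod (x - y)"
    and low: "(q - \<eta>) * cmod (x - y) \<le> cmod (poly p x - poly p y)"
    if "x \<in> ball z0 R" "y \<in> ball z0 R" for x y
  proof -
    have *: "cmod (poly p x - poly p y - poly (pderiv p) z0 * (x - y)) \<le> \<eta> * cmod (x - y)"
      using that by (intro R2) (auto simp: R_def)
    have n: "cmod (poly (pderiv p) z0 * (x - y)) = q * cmod (x - y)" by (simp add: q_def norm_mult)
    show "cmod (poly p x - poly p y) \<le> (q + \<eta>) * cmod (x - y)"
      using * norm_triangle_sub[of "poly p x - poly p y" "poly (pderiv p) z0 * (x - y)"] n
      by (simp add: algebra_simps)
    show "(q - \<eta>) * cmod (x - y) \<le> cmod (poly p x - poly p y)"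
      using * norm_triangle_sub[of "poly (pderiv p) z0 * (x - y)" "poly p x - poly p y"] n
      by (simp add: algebra_simps norm_minus_commute)
  qed
  have inj: "inj_on (poly p) (ball z0 R)"
  proof (rule inj_onI)
    fix x y assume "x \<in> ball z0 R" "y \<in> ball z0 R" "poly p x = poly p y"
    with low[of x y] have "(q - \<eta>) * cmod (x - y) \<le> 0" by simp
    then show "x = y" using \<eta> by (simp add: mult_le_0_iff)
  qed
  show ?thesis
  proof (rule that[OF R inj])
    show "\<bar>f x - f z0\<bar> < e" if "x \<in> ball z0 R" for x
      using R4(2)[of x] that by (simp add: R_def dist_commute dist_real_def)
  next
    fix A :: "complex set" and a b :: real
    assume A: "A \<in> sets borel" "A \<subseteq> ball z0 R" and ab: "a \<le> b" "b - a < R"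
      and img: "poly p ` A = cis ` {a<..b}"
    let ?I = "\<integral>\<^sup>+z. ennreal (f z * cmod (poly (pderiv p) z)) * indicator A z \<partial>arc_length"
    have chord: "(1 - \<eta>) * \<bar>s - t\<bar> \<le> cmod (cis s - cis t)" if "s \<in> {a<..b}" "t \<in> {a<..b}" for s t
      using that ab by (intro R1(2)) (auto simp: R_def)
    have cis_inj: "inj_on cis {a<..b}"
    proof (rule inj_onI)
      fix s t assume "s \<in> {a<..b}" "t \<in> {a<..b}" "cis s = cis t"
      with chord[of s t] have "(1 - \<eta>) * \<bar>s - t\<bar> \<le> 0" by simp
      then show "s = t" using \<eta> by (simp add: mult_le_0_iff)
    qed
    have injA: "inj_on (poly p) A" using inj A(2) by (rule inj_on_subset)
    have HA_le: "hausdorff1_outer A \<le> ennreal (1 / (q - \<eta>)) * ennreal (b - a)"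
    proof -
      \<comment> \<open>The inverse branch of \<open>p\<close> along the arc; \<open>low\<close>
        makes it Lipschitz.\<close>
      define h where "h s = inv_into A (poly p) (cis s)" for s
      have h: "h s \<in> A" "poly p (h s) = cis s" if "s \<in> {a<..b}" for s
        using that img unfolding h_def by (auto intro: inv_into_into f_inv_into_f)
      have "A \<subseteq> h ` {a<..b}"
      proof
        fix x assume x: "x \<in> A"
        then obtain s where s: "s \<in> {a<..b}" "poly p x = cis s" using img by blast
        then have "h s = x" using inv_into_f_f[OF injA x] by (simp add: h_def)
        then show "x \<in> h ` {a<..b}" using s by blast
      qed
      then have "hausdorff1_outer A \<le> hausdorff1_outer (h ` {a<..b})" by (rule hausdorff1_outer_mono)
      also have "\<dots> \<le> ennreal (1 / (q - \<eta>)) * hausdorff1_outer {a<..b}"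
      proof (rule hausdorff1_outer_Lipschitz_image)
        fix s t assume st: "s \<in> {a<..b}" "t \<in> {a<..b}"
        have "(q - \<eta>) * cmod (h s - h t) \<le> cmod (cis s - cis t)"
          using low[of "h s" "h t"] h[OF st(1)] h[OF st(2)] A(2) by (metis subsetD)
        also have "\<dots> \<le> \<bar>s - t\<bar>" by (rule cmod_cis_diff_le)
        finally show "dist (h s) (h t) \<le> 1 / (q - \<eta>) * dist s t"
          using \<eta> by (simp add: dist_norm field_simps)
      qed (use \<eta> in simp)
      finally show ?thesis using ab by (simp add: hausdorff1_outer_interval)
    qed
    have HA_ge: "ennreal (b - a) \<le> ennreal ((q + \<eta>) / (1 - \<eta>)) * hausdorff1_outer A"
    proof -
      \<comment> \<open>The angle of \<open>p x\<close>, inverse to the branch used for the upper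
        bound; \<open>chord\<close> and \<open>up\<close> make it Lipschitz.\<close>
      define k where "k x = inv_into {a<..b} cis (poly p x)" for x
      have k: "k x \<in> {a<..b}" "cis (k x) = poly p x" if "x \<in> A" for x
      proof -
        have "poly p x \<in> cis ` {a<..b}" using that img by blast
        then show "k x \<in> {a<..b}" "cis (k x) = poly p x"
          unfolding k_def by (rule inv_into_into, rule f_inv_into_f)
      qed
      have "{a<..b} \<subseteq> k ` A"
      proof
        fix s assume s: "s \<in> {a<..b}"
        then obtain x where x: "x \<in> A" "poly p x = cis s" using img by (metis imageE imageI)
        then have "k x = s" using inv_into_f_f[OF cis_inj s] by (simp add: k_def)
        then show "s \<in> k ` A" using x by blast
      qed
      then have "hausdorff1_outer {a<..b} \<le> hausdorff1_outer (k ` A)" by (rule hausdorff1_outer_mono)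
      also have "\<dots> \<le> ennreal ((q + \<eta>) / (1 - \<eta>)) * hausdorff1_outer A"
      proof (rule hausdorff1_outer_Lipschitz_image)
        fix x y assume xy: "x \<in> A" "y \<in> A"
        have "(1 - \<eta>) * \<bar>k x - k y\<bar> \<le> cmod (poly p x - poly p y)"
          using chord[of "k x" "k y"] k[OF xy(1)] k[OF xy(2)] by metis
        also have "\<dots> \<le> (q + \<eta>) * cmod (x - y)" using xy A(2) by (intro up) auto
        finally show "dist (k x) (k y) \<le> (q + \<eta>) / (1 - \<eta>) * dist x y"
          using \<eta> by (simp add: dist_norm field_simps)
      qed (use \<eta> q in simp)
      finally show ?thesis using ab by (simp add: hausdorff1_outer_interval)
    qed
    have val: "f x * cmod (poly (pderiv p) x) \<le> \<phi> * q + \<eta>"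
        "\<phi> * q - \<eta> \<le> f x * cmod (poly (pderiv p) x)" if "x \<in> A" for x
    proof -
      have "dist x z0 < R3" using that A(2) by (auto simp: R_def dist_commute)
      from R3(2)[OF this] show "f x * cmod (poly (pderiv p) x) \<le> \<phi> * q + \<eta>"
        "\<phi> * q - \<eta> \<le> f x * cmod (poly (pderiv p) x)"
        unfolding dist_real_def \<phi>_def q_def by linarith+
    qed
    have "?I \<le> (\<integral>\<^sup>+z. ennreal (\<phi> * q + \<eta>) * indicator A z \<partial>arc_length)"
      by (intro nn_integral_mono) (use val(1) in \<open>auto intro!: ennreal_leI split: split_indicator\<close>)
    also have "\<dots> = ennreal (\<phi> * q + \<eta>) * hausdorff1_outer A"
      using A by (simp add: nn_integral_cmult_indicator emeasure_arc_length)
    also have "\<dots> \<le> ennreal (\<phi> * q + \<eta>) * (ennreal (1 / (q - \<eta>)) * ennreal (b - a))"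
      by (intro mult_left_mono HA_le) simp
    also have "\<dots> = ennreal ((\<phi> * q + \<eta>) / (q - \<eta>) * (b - a))"
      using \<phi> q \<eta> ab by (simp flip: ennreal_mult del: ennreal_plus)
    also have "\<dots> \<le> ennreal ((\<phi> + e) * (b - a))"
      using \<eta>(1) ab by (intro ennreal_leI mult_right_mono) auto
    finally have upper: "?I \<le> ennreal ((f z0 + e) * (b - a))" by (simp add: \<phi>_def)
    have lower: "ennreal ((f z0 - e) * (b - a)) \<le> ?I"
    proof (cases "\<phi> * q - \<eta> \<ge> 0")
      case True
      have "ennreal ((\<phi> - e) * (b - a)) \<le> ennreal ((\<phi> * q - \<eta>) * ((1 - \<eta>) / (q + \<eta>)) * (b - a))"
        using \<eta>(2) ab by (intro ennreal_leI mult_right_mono) auto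
      also have "\<dots> = ennreal (\<phi> * q - \<eta>) * (ennreal ((1 - \<eta>) / (q + \<eta>)) * ennreal (b - a))"
        using True \<eta> q ab by (simp flip: ennreal_mult add: mult.assoc)
      also have "\<dots> \<le> ennreal (\<phi> * q - \<eta>) *
          (ennreal ((1 - \<eta>) / (q + \<eta>)) * (ennreal ((q + \<eta>) / (1 - \<eta>)) * hausdorff1_outer A))"
        by (intro mult_left_mono HA_ge) auto
      also have "ennreal ((1 - \<eta>) / (q + \<eta>)) * (ennreal ((q + \<eta>) / (1 - \<eta>)) * hausdorff1_outer A)
          = ennreal ((1 - \<eta>) / (q + \<eta>) * ((q + \<eta>) / (1 - \<eta>))) * hausdorff1_outer A"
        using \<eta> q by (subst ennreal_mult) (auto simp: mult.assoc)
      also have "(1 - \<eta>) / (q + \<eta>) * ((q + \<eta>) / (1 - \<eta>)) = 1" using \<eta> q by simp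
      also have "ennreal (\<phi> * q - \<eta>) * (ennreal 1 * hausdorff1_outer A)
          = (\<integral>\<^sup>+z. ennreal (\<phi> * q - \<eta>) * indicator A z \<partial>arc_length)"
        using A by (simp add: nn_integral_cmult_indicator emeasure_arc_length)
      also have "\<dots> \<le> ?I"
        by (intro nn_integral_mono) (use val(2) in \<open>auto intro!: ennreal_leI split: split_indicator\<close>)
      finally show ?thesis by (simp add: \<phi>_def)
    next
      \<comment> \<open>The left-hand side is then the \<open>ennreal\<close> of a nonpositive
        number, which is 0.\<close>
      case False
      have "(1 - \<eta>) / (q + \<eta>) \<ge> 0" using \<eta> q by simp
      then have "(\<phi> * q - \<eta>) * ((1 - \<eta>) / (q + \<eta>)) \<le> 0"
        using False by (intro mult_nonpos_nonneg) auto
      then have "(\<phi> - e) * (b - a) \<le> 0"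
        using \<eta>(2) ab by (intro mult_nonpos_nonneg) auto
      then show ?thesis by (simp add: \<phi>_def ennreal_neg)
    qed
    show "ennreal ((f z0 - e) * (b - a)) \<le> ?I \<and> ?I \<le> ennreal ((f z0 + e) * (b - a))"
      using upper lower by blast
  qed
qed

section \<open>Fibres of a polynomial over the circle\<close>

lemma degree_minus_const_poly:
  fixes p :: "'a::comm_ring_1 poly"
  assumes "degree p > 0" shows "degree (p - [:c:]) = degree p"
  unfolding diff_conv_add_uminus by (rule degree_add_eq_left) (use assms in simp)

lemma card_preimage_poly:
  fixes p :: "complex poly"
  assumes deg: "degree p > 0"
  shows "finite {z. poly p z = w}" "card {z. poly p z = w} \<le> degree p"
    and "(\<And>z. poly p z = w \<Longrightarrow> poly (pderiv p) z \<noteq> 0) \<Longrightarrow> card {z. poly p z = w} = degree p"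
proof -
  have eq: "{z. poly p z = w} = {z. poly (p - [:w:]) z = 0}" by auto
  have d: "degree (p - [:w:]) = degree p" using deg by (rule degree_minus_const_poly)
  have nz: "p - [:w:] \<noteq> 0" using d deg by auto
  show "finite {z. poly p z = w}" unfolding eq using nz by (rule poly_roots_finite)
  show "card {z. poly p z = w} \<le> degree p"
    unfolding eq using card_poly_roots_bound[OF nz] d by simp
  assume "\<And>z. poly p z = w \<Longrightarrow> poly (pderiv p) z \<noteq> 0"
  then have "rsquarefree (p - [:w:])"
    unfolding rsquarefree_roots by (auto simp: pderiv_diff pderiv_pCons)
  from rsquarefree_card_roots[OF this] show "card {z. poly p z = w} = degree p"
    unfolding eq d .
qed

lemma open_poly_image:
  fixes p :: "complex poly"
  assumes deg: "degree p > 0" and U: "open U"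
  shows "open (poly p ` U)"
proof (rule open_mapping_thm[of "poly p" UNIV])
  show "\<not> poly p constant_on UNIV"
    using constant_degree[of p] deg unfolding constant_on_def constant_def
    by (metis UNIV_I less_irrefl)
qed (use U in \<open>auto intro!: holomorphic_intros\<close>)

text \<open>A regular fibre has exactly \<open>m\<close> points, which get disjoint balls. By the
  open mapping theorem each ball meets every nearby fibre, and as a fibre has at most
  \<open>m\<close> points it meets it exactly once. So \<open>G\<close> is continuous at
  \<open>t\<close>, and the preimage of a short arc consists of \<open>m\<close> pieces, each
  estimated with error \<open>e / m\<close>.\<close>

lemma lemniscate_local_estimate:
  fixes p :: "complex poly" and f :: "complex \<Rightarrow> real"
  assumes deg: "degree p > 0" and nonneg: "\<And>z. f z \<ge> 0" and meas: "f \<in> borel_measurable borel"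
    and regular: "\<And>z. poly p z = cis t \<Longrightarrow> poly (pderiv p) z \<noteq> 0" "\<And>z. poly p z = cis t \<Longrightarrow> isCont f z"
    and e: "e > 0"
  defines "G \<equiv> \<lambda>s. \<Sum>z | poly p z = cis s. f z"
  obtains \<delta> where "\<delta> > 0" "\<And>s. \<bar>s - t\<bar> < \<delta> \<Longrightarrow> \<bar>G s - G t\<bar> \<le> e"
    and "\<And>a b. a \<le> t \<Longrightarrow> t \<le> b \<Longrightarrow> b - a < \<delta> \<Longrightarrow>
      ennreal ((G t - e) * (b - a)) \<le> (\<integral>\<^sup>+z. ennreal (f z * cmod (poly (pderiv p) z)) *
         indicator {z. poly p z \<in> cis ` {a<..b}} z \<partial>arc_length) \<and>
      (\<integral>\<^sup>+z. ennreal (f z * cmod (poly (pderiv p) z)) *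
         indicator {z. poly p z \<in> cis ` {a<..b}} z \<partial>arc_length) \<le> ennreal ((G t + e) * (b - a))"
proof -
  define Z where "Z = {z. poly p z = cis t}"
  define m where "m = degree p"
  have Z: "finite Z" "card Z = m"
    using card_preimage_poly[OF deg, of "cis t"] regular by (auto simp: Z_def m_def)
  have m: "m > 0" using deg by (simp add: m_def)
  define e' where "e' = e / m"
  have e': "e' > 0" "m * e' = e" using e m by (auto simp: e'_def)
  define good where "good z R \<longleftrightarrow> R > 0 \<and> inj_on (poly p) (ball z R) \<and>
      (\<forall>x\<in>ball z R. \<bar>f x - f z\<bar> < e') \<and> (\<forall>y\<in>Z. y \<noteq> z \<longrightarrow> 2 * R \<le> dist z y) \<and>
      (\<forall>A a b. A \<in> sets borel \<longrightarrow> A \<subseteq> ball z R \<longrightarrow> a \<le> b \<longrightarrow> b - a < R \<longrightarrow>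
         poly p ` A = cis ` {a<..b} \<longrightarrow>
      ennreal ((f z - e') * (b - a))
        \<le> (\<integral>\<^sup>+z. ennreal (f z * cmod (poly (pderiv p) z)) * indicator A z \<partial>arc_length) \<and>
      (\<integral>\<^sup>+z. ennreal (f z * cmod (poly (pderiv p) z)) * indicator A z \<partial>arc_length)
        \<le> ennreal ((f z + e') * (b - a)))" for z R
  have "\<exists>R. good z R" if z: "z \<in> Z" for z
  proof -
    obtain d where d: "d > 0" "\<forall>y\<in>Z. y \<noteq> z \<longrightarrow> d \<le> dist z y"
      using finite_set_avoid[OF Z(1), of z] by blast
    have reg: "poly (pderiv p) z \<noteq> 0" "isCont f z" using regular z by (auto simp: Z_def)
    obtain R where R: "R > 0" "inj_on (poly p) (ball z R)" "\<And>x. x \<in> ball z R \<Longrightarrow> \<bar>f x - f z\<bar> < e'"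
      "\<And>A a b. A \<in> sets borel \<Longrightarrow> A \<subseteq> ball z R \<Longrightarrow> a \<le> b \<Longrightarrow> b - a < R \<Longrightarrow>
         poly p ` A = cis ` {a<..b} \<Longrightarrow>
      ennreal ((f z - e') * (b - a))
        \<le> (\<integral>\<^sup>+z. ennreal (f z * cmod (poly (pderiv p) z)) * indicator A z \<partial>arc_length) \<and>
      (\<integral>\<^sup>+z. ennreal (f z * cmod (poly (pderiv p) z)) * indicator A z \<partial>arc_length)
        \<le> ennreal ((f z + e') * (b - a))"
      using arc_piece_estimate[OF reg(1) nonneg reg(2) e'(1)] by blast
    define R' where "R' = min R (d / 2)"
    have sub: "ball z R' \<subseteq> ball z R" by (auto simp: R'_def)
    have "good z R'"
      unfolding good_def
    proof (intro conjI allI impI ballI)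
      show "R' > 0" using R d by (simp add: R'_def)
      show "inj_on (poly p) (ball z R')" using R(2) sub by (rule inj_on_subset)
      show "2 * R' \<le> dist z y" if "y \<in> Z" "y \<noteq> z" for y using d that by (force simp: R'_def)
      show "\<bar>f x - f z\<bar> < e'" if "x \<in> ball z R'" for x using R(3) sub that by blast
    next
      fix A :: "complex set" and a b :: real
      assume *: "A \<in> sets borel" "A \<subseteq> ball z R'" "a \<le> b" "b - a < R'" "poly p ` A = cis ` {a<..b}"
      have **: "A \<subseteq> ball z R" "b - a < R" using *(2,4) sub by (auto simp: R'_def)
      show "ennreal ((f z - e') * (b - a))
          \<le> (\<integral>\<^sup>+z. ennreal (f z * cmod (poly (pderiv p) z)) * indicator A z \<partial>arc_length)"
        using R(4)[OF *(1) **(1) *(3) **(2) *(5)] by blast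
      show "(\<integral>\<^sup>+z. ennreal (f z * cmod (poly (pderiv p) z)) * indicator A z \<partial>arc_length)
          \<le> ennreal ((f z + e') * (b - a))"
        using R(4)[OF *(1) **(1) *(3) **(2) *(5)] by blast
    qed
    then show ?thesis by blast
  qed
  then have "\<forall>z\<in>Z. \<exists>R. good z R" by blast
  from bchoice[OF this] obtain R where R: "\<And>z. z \<in> Z \<Longrightarrow> good z (R z)" by blast
  have Rpos: "R z > 0" if "z \<in> Z" for z using R[OF that] by (simp add: good_def)
  have Rsep: "2 * R z \<le> dist z y" if "z \<in> Z" "y \<in> Z" "y \<noteq> z" for z y
    using R[OF that(1)] that unfolding good_def by meson
  have Rnear: "\<bar>f x - f z\<bar> < e'" if "z \<in> Z" "x \<in> ball z (R z)" for z x
    using R[OF that(1)] that unfolding good_def by meson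
  have disj: "ball x (R x) \<inter> ball y (R y) = {}" if "x \<in> Z" "y \<in> Z" "x \<noteq> y" for x y
  proof (rule disjoint_ballI)
    have "2 * R x \<le> dist x y" "2 * R y \<le> dist y x" using Rsep that by auto
    then show "dist x y \<ge> R x + R y" by (simp add: dist_commute)
  qed
  have "\<exists>\<delta>>0. \<forall>s. \<bar>s - t\<bar> < \<delta> \<longrightarrow> cis s \<in> poly p ` ball z (R z)" if z: "z \<in> Z" for z
  proof -
    have "open (poly p ` ball z (R z))" by (rule open_poly_image[OF deg open_ball])
    then have "open (cis -` (poly p ` ball z (R z)))"
      by (intro open_vimage continuous_intros) auto
    moreover have "t \<in> cis -` (poly p ` ball z (R z))"
      using z Rpos[OF z] by (auto simp: Z_def intro!: image_eqI[of _ _ z])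
    ultimately obtain \<delta> where "\<delta> > 0" "ball t \<delta> \<subseteq> cis -` (poly p ` ball z (R z))"
      using open_contains_ball by blast
    then show ?thesis by (intro exI[of _ \<delta>]) (auto simp: dist_real_def subset_iff abs_minus_commute)
  qed
  then obtain D where D: "\<And>z. z \<in> Z \<Longrightarrow> D z > 0"
      "\<And>z s. z \<in> Z \<Longrightarrow> \<bar>s - t\<bar> < D z \<Longrightarrow> cis s \<in> poly p ` ball z (R z)"
    by metis
  have Zne: "Z \<noteq> {}" using Z m by auto
  define \<delta> where "\<delta> = Min ((\<lambda>z. min (R z) (D z)) ` Z)"
  have \<delta>: "\<delta> > 0" using Z Zne Rpos D by (auto simp: \<delta>_def)
  have \<delta>le: "\<delta> \<le> R z" "\<delta> \<le> D z" if "z \<in> Z" for z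
  proof -
    have "\<delta> \<le> min (R z) (D z)" unfolding \<delta>_def using Z that by (intro Min_le) auto
    then show "\<delta> \<le> R z" "\<delta> \<le> D z" by auto
  qed
  have preimages: "\<exists>c. {w. poly p w = cis s} = c ` Z \<and> inj_on c Z \<and> (\<forall>z\<in>Z. c z \<in> ball z (R z))"
    if s: "\<bar>s - t\<bar> < \<delta>" for s
  proof -
    have "\<exists>w. w \<in> ball z (R z) \<and> poly p w = cis s" if "z \<in> Z" for z
      using D(2)[OF that, of s] \<delta>le[OF that] s by (auto simp: image_iff)
    then obtain c where c: "\<And>z. z \<in> Z \<Longrightarrow> c z \<in> ball z (R z)" "\<And>z. z \<in> Z \<Longrightarrow> poly p (c z) = cis s"
      by metis
    have inj: "inj_on c Z"
      by (rule inj_onI) (metis c(1) disj disjoint_iff)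
    have "c ` Z = {w. poly p w = cis s}"
    \<comment> \<open>Disjointness of the balls makes the chosen preimages distinct, and
      \<open>m\<close> of them exhaust the fibre.\<close>
    proof (rule card_seteq)
      show "card {w. poly p w = cis s} \<le> card (c ` Z)"
        using card_preimage_poly(2)[OF deg] inj Z by (simp add: card_image m_def)
    qed (use c card_preimage_poly(1)[OF deg] in auto)
    with inj c show ?thesis by metis
  qed
  show ?thesis
  proof (rule that[OF \<delta>])
    fix s assume "\<bar>s - t\<bar> < \<delta>"
    from preimages[OF this] obtain c where c: "{w. poly p w = cis s} = c ` Z" "inj_on c Z"
        "\<And>z. z \<in> Z \<Longrightarrow> c z \<in> ball z (R z)" by blast
    have "G s - G t = (\<Sum>z\<in>Z. f (c z) - f z)"
      unfolding G_def c(1) using c(2) by (simp add: sum.reindex sum_subtractf Z_def)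
    also have "\<bar>\<dots>\<bar> \<le> (\<Sum>z\<in>Z. \<bar>f (c z) - f z\<bar>)" by (rule sum_abs)
    also have "\<dots> \<le> (\<Sum>z\<in>Z. e')"
      using Rnear c(3) by (intro sum_mono less_imp_le) blast
    also have "\<dots> = e" using Z e' by simp
    finally show "\<bar>G s - G t\<bar> \<le> e" .
  next
    fix a b assume ab: "a \<le> t" "t \<le> b" "b - a < \<delta>"
    define X where "X = {z. poly p z \<in> cis ` {a<..b}}"
    define A where "A z = ball z (R z) \<inter> X" for z
    let ?g = "\<lambda>z. ennreal (f z * cmod (poly (pderiv p) z))"
    have near: "\<bar>s - t\<bar> < \<delta>" if "s \<in> {a<..b}" for s using that ab by auto
    have p_meas: "poly q \<in> borel_measurable borel" for q :: "complex poly"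
      by (intro borel_measurable_continuous_onI continuous_intros)
    have X: "X \<in> sets borel"
      using measurable_sets[OF p_meas cis_interval_borel[of a b], of p] by (simp add: X_def vimage_def)
    then have A: "A z \<in> sets borel" for z by (auto simp: A_def)
    have imgA: "poly p ` A z = cis ` {a<..b}" if "z \<in> Z" for z
    proof (intro equalityI subsetI)
      fix u assume "u \<in> cis ` {a<..b}"
      then obtain s where s: "s \<in> {a<..b}" "u = cis s" by blast
      then have "cis s \<in> poly p ` ball z (R z)"
        using near[of s] \<delta>le[OF that] by (intro D(2)[OF that]) auto
      then obtain w where "w \<in> ball z (R z)" "poly p w = cis s" by (metis imageE)
      then have "w \<in> A z" using s by (simp add: A_def X_def)
      then show "u \<in> poly p ` A z" using s(2) \<open>poly p w = cis s\<close> by (metis imageI)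
    qed (auto simp: A_def X_def)
    have XA: "X = (\<Union>z\<in>Z. A z)"
    proof (intro equalityI subsetI)
      fix w assume w: "w \<in> X"
      then obtain s where s: "s \<in> {a<..b}" "poly p w = cis s" by (auto simp: X_def)
      from preimages[OF near[OF s(1)]] obtain c where
        c: "{w. poly p w = cis s} = c ` Z" "\<forall>z\<in>Z. c z \<in> ball z (R z)" by blast
      have "w \<in> c ` Z" using s(2) unfolding c(1)[symmetric] by simp
      then obtain z where "z \<in> Z" "w \<in> ball z (R z)" using c(2) by blast
      then show "w \<in> (\<Union>z\<in>Z. A z)" using w by (auto simp: A_def)
    qed (auto simp: A_def)
    have "disjoint_family_on A Z"
      unfolding disjoint_family_on_def A_def using disj by blast
    then have ind: "(indicator X w :: ennreal) = (\<Sum>z\<in>Z. indicator (A z) w)" for w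
      unfolding XA by (rule indicator_UN_disjoint[OF Z(1)])
    have g_meas: "?g \<in> borel_measurable arc_length"
      using meas p_meas by (simp cong: measurable_cong_sets)
    have "(\<integral>\<^sup>+z. ?g z * indicator X z \<partial>arc_length) = (\<integral>\<^sup>+w. (\<Sum>z\<in>Z. ?g w * indicator (A z) w) \<partial>arc_length)"
      unfolding ind by (simp add: sum_distrib_left)
    also have "\<dots> = (\<Sum>z\<in>Z. \<integral>\<^sup>+w. ?g w * indicator (A z) w \<partial>arc_length)"
      using A g_meas by (intro nn_integral_sum borel_measurable_times_ennreal) auto
    finally have I: "(\<integral>\<^sup>+z. ?g z * indicator X z \<partial>arc_length) = (\<Sum>z\<in>Z. \<integral>\<^sup>+w. ?g w * indicator (A z) w \<partial>arc_length)" .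
    have est: "ennreal ((f z - e') * (b - a)) \<le> (\<integral>\<^sup>+w. ?g w * indicator (A z) w \<partial>arc_length) \<and>
        (\<integral>\<^sup>+w. ?g w * indicator (A z) w \<partial>arc_length) \<le> ennreal ((f z + e') * (b - a))" if "z \<in> Z" for z
    proof -
      have "a \<le> b" "b - a < R z" "A z \<subseteq> ball z (R z)" using ab \<delta>le(1)[OF that] by (auto simp: A_def)
      then show ?thesis using R[OF that] A[of z] imgA[OF that] unfolding good_def by meson
    qed
    have "(\<Sum>z\<in>Z. \<integral>\<^sup>+w. ?g w * indicator (A z) w \<partial>arc_length) \<le> (\<Sum>z\<in>Z. ennreal ((f z + e') * (b - a)))"
      using est by (intro sum_mono) blast
    also have "\<dots> = ennreal (\<Sum>z\<in>Z. (f z + e') * (b - a))"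
      using ab e' nonneg by (intro sum_ennreal) auto
    also have "(\<Sum>z\<in>Z. (f z + e') * (b - a)) = (G t + e) * (b - a)"
      using e' Z by (simp add: G_def Z_def[symmetric] sum.distrib flip: sum_distrib_right)
    finally have upper: "(\<integral>\<^sup>+z. ?g z * indicator X z \<partial>arc_length) \<le> ennreal ((G t + e) * (b - a))"
      unfolding I .
    have "(G t - e) * (b - a) = (\<Sum>z\<in>Z. (f z - e') * (b - a))"
      using e' Z by (simp add: G_def Z_def[symmetric] sum_subtractf flip: sum_distrib_right)
    \<comment> \<open>Individual summands may be negative; clipping them only enlarges the sum and
      lets \<open>ennreal\<close> commute with it.\<close>
    also have "\<dots> \<le> (\<Sum>z\<in>Z. max 0 ((f z - e') * (b - a)))"
      by (intro sum_mono) simp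
    finally have "ennreal ((G t - e) * (b - a)) \<le> ennreal (\<Sum>z\<in>Z. max 0 ((f z - e') * (b - a)))"
      by (rule ennreal_leI)
    also have "\<dots> = (\<Sum>z\<in>Z. ennreal (max 0 ((f z - e') * (b - a))))"
      by (rule sum_ennreal[symmetric]) simp
    also have "\<dots> = (\<Sum>z\<in>Z. ennreal ((f z - e') * (b - a)))"
      by (intro sum.cong) (auto simp: max_def ennreal_neg)
    also have "\<dots> \<le> (\<Sum>z\<in>Z. \<integral>\<^sup>+w. ?g w * indicator (A z) w \<partial>arc_length)"
      using est by (intro sum_mono) blast
    finally have "ennreal ((G t - e) * (b - a)) \<le> (\<integral>\<^sup>+z. ?g z * indicator X z \<partial>arc_length)"
      unfolding I .
    then show "ennreal ((G t - e) * (b - a)) \<le> (\<integral>\<^sup>+z. ?g z * indicator {z. poly p z \<in> cis ` {a<..b}} z \<partial>arc_length) \<and>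
      (\<integral>\<^sup>+z. ?g z * indicator {z. poly p z \<in> cis ` {a<..b}} z \<partial>arc_length) \<le> ennreal ((G t + e) * (b - a))"
      using upper unfolding X_def by blast
  qed
qed

section \<open>Change of variables from the lemniscate to the angle\<close>

lemma borel_measurable_poly: "poly (q :: complex poly) \<in> borel_measurable borel"
  by (intro borel_measurable_continuous_onI continuous_intros)

text \<open>Despite the jump along the positive real axis, the sublevel sets are closed.\<close>

lemma borel_measurable_Arg2pi: "Arg2pi \<in> borel_measurable borel"
  unfolding borel_measurable_iff_le using closed_Arg2pi2pi_le by (auto intro: borel_closed)

lemma Arg2pi_in_interval_iff:
  assumes "0 \<le> a" "b < 2 * pi" "cmod u = 1"
  shows "Arg2pi u \<in> {a<..b} \<longleftrightarrow> u \<in> cis ` {a<..b}"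
proof
  assume "Arg2pi u \<in> {a<..b}"
  moreover have "u = cis (Arg2pi u)" using assms(3) by (metis complex_norm_eq_1_exp cis_conv_exp)
  ultimately show "u \<in> cis ` {a<..b}" by blast
next
  assume "u \<in> cis ` {a<..b}"
  then obtain s where s: "s \<in> {a<..b}" "u = cis s" by blast
  have "Arg2pi u = s"
    by (rule Arg2pi_unique[of 1]) (use s assms in \<open>auto simp: cis_conv_exp\<close>)
  then show "Arg2pi u \<in> {a<..b}" using s by simp
qed

text \<open>Both sides are masses of \<open>{0<..<2*pi}\<close>: under the push-forward
  \<open>M\<close> by the angle \<open>\<tau>\<close>, and under the measure \<open>N\<close> with
  density \<open>g\<close>. Off \<open>S\<close> the local estimates give both the slope
  \<open>G t\<close> at \<open>t\<close>; single angles have mass 0 under both.\<close>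

lemma nn_integral_lemniscate:
  fixes p :: "complex poly" and f :: "complex \<Rightarrow> real" and S :: "real set"
  assumes deg: "degree p > 0" and nonneg: "\<And>z. f z \<ge> 0" and meas: "f \<in> borel_measurable borel"
    and S: "finite S"
    and regular: "\<And>t z. t \<in> {0<..<2*pi} - S \<Longrightarrow> poly p z = cis t \<Longrightarrow> poly (pderiv p) z \<noteq> 0"
      "\<And>t z. t \<in> {0<..<2*pi} - S \<Longrightarrow> poly p z = cis t \<Longrightarrow> isCont f z"
  defines "G \<equiv> \<lambda>s. \<Sum>z | poly p z = cis s. f z"
  shows "(\<integral>\<^sup>+z. ennreal (f z * cmod (poly (pderiv p) z)) * indicator {z. cmod (poly p z) = 1} z \<partial>arc_length)
       = (\<integral>\<^sup>+t. ennreal (G t) * indicator ({0<..<2*pi} - S) t \<partial>lborel)"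
proof -
  define Q where "Q = {0<..<2*pi} - S"
  have Qopen: "open Q" using S by (auto simp: Q_def intro: open_Diff finite_imp_closed)
  have local: "\<exists>\<delta>>0. (\<forall>s. \<bar>s - t\<bar> < \<delta> \<longrightarrow> \<bar>G s - G t\<bar> \<le> e) \<and>
      (\<forall>a b. a \<le> t \<longrightarrow> t \<le> b \<longrightarrow> b - a < \<delta> \<longrightarrow>
          ennreal ((G t - e) * (b - a)) \<le> (\<integral>\<^sup>+z. ennreal (f z * cmod (poly (pderiv p) z)) *
             indicator {z. poly p z \<in> cis ` {a<..b}} z \<partial>arc_length) \<and>
          (\<integral>\<^sup>+z. ennreal (f z * cmod (poly (pderiv p) z)) *
             indicator {z. poly p z \<in> cis ` {a<..b}} z \<partial>arc_length) \<le> ennreal ((G t + e) * (b - a)))"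
    if t: "t \<in> Q" and e: "e > 0" for t e
    unfolding G_def
  proof (rule lemniscate_local_estimate[OF deg nonneg meas _ _ e, of t], goal_cases)
    case (1 z) then show ?case using regular(1) t by (simp add: Q_def)
  next
    case (2 z) then show ?case using regular(2) t by (simp add: Q_def)
  next
    case (3 \<delta>)
    show ?case by (intro exI[of _ \<delta>] conjI allI impI) (fact 3(1), erule 3(2), rule 3(3)[THEN conjunct1], assumption+,
          rule 3(3)[THEN conjunct2])
  qed
  \<comment> \<open>Continuity off the exceptional angles is what makes \<open>g\<close>
    measurable.\<close>
  have cont: "continuous_on Q G"
  proof (rule continuous_at_imp_continuous_on, rule ballI)
    fix t assume t: "t \<in> Q"
    show "isCont G t"
      unfolding continuous_at_eps_delta
    proof (intro allI impI)
      fix e :: real assume e: "e > 0"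
      then have "e / 2 > 0" by simp
      from local[OF t this] obtain \<delta> where "\<delta> > 0" "\<And>s. \<bar>s - t\<bar> < \<delta> \<Longrightarrow> \<bar>G s - G t\<bar> \<le> e / 2"
        by blast
      then show "\<exists>d>0. \<forall>x'. dist x' t < d \<longrightarrow> dist (G x') (G t) < e"
        using e by (intro exI[of _ \<delta>]) (force simp: dist_real_def)
    qed
  qed
  define g where "g t = ennreal (G t) * indicator Q t" for t
  have g_eq: "g = (\<lambda>t. ennreal (indicator Q t *\<^sub>R G t))"
    by (auto simp: g_def split: split_indicator)
  have g_meas: "g \<in> borel_measurable borel"
    unfolding g_eq using cont Qopen
    by (intro measurable_compose[OF _ measurable_ennreal] borel_measurable_continuous_on_indicator) auto
  define w where "w z = ennreal (f z * cmod (poly (pderiv p) z)) * indicator {z. cmod (poly p z) = 1} z" for z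
  have L: "{z. cmod (poly p z) = 1} \<in> sets borel"
    by (intro borel_closed closed_Collect_eq continuous_intros)
  have w_meas: "w \<in> borel_measurable arc_length"
    unfolding w_def using meas borel_measurable_poly L by (simp cong: measurable_cong_sets)
  define \<tau> where "\<tau> z = Arg2pi (poly p z)" for z
  have \<tau>_meas: "\<tau> \<in> borel_measurable borel"
    unfolding \<tau>_def by (rule measurable_compose[OF borel_measurable_poly borel_measurable_Arg2pi])
  define M where "M = distr (density arc_length w) borel \<tau>"
  define N where "N = density lborel g"
  have sM: "sets M = sets borel" and sN: "sets N = sets borel" by (auto simp: M_def N_def)
  have eM: "emeasure M B = (\<integral>\<^sup>+z. w z * indicator (\<tau> -` B) z \<partial>arc_length)" if "B \<in> sets borel" for B
  proof -
    have "\<tau> -` B \<in> sets borel" using measurable_sets[OF \<tau>_meas that] by simp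
    then show ?thesis
      unfolding M_def using that \<tau>_meas w_meas
      by (simp add: emeasure_distr emeasure_density measurable_cong_sets[OF sets_arc_length refl])
  qed
  have eN: "emeasure N B = (\<integral>\<^sup>+t. g t * indicator B t \<partial>lborel)" if "B \<in> sets borel" for B
    unfolding N_def using that g_meas by (simp add: emeasure_density)
  have eM_int: "emeasure M {a<..b} = (\<integral>\<^sup>+z. ennreal (f z * cmod (poly (pderiv p) z)) *
         indicator {z. poly p z \<in> cis ` {a<..b}} z \<partial>arc_length)" if "0 \<le> a" "b < 2*pi" for a b
  proof -
    have "w z * indicator (\<tau> -` {a<..b}) z =
        ennreal (f z * cmod (poly (pderiv p) z)) * indicator {z. poly p z \<in> cis ` {a<..b}} z" for z
    proof (cases "cmod (poly p z) = 1")
      case True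
      then show ?thesis using Arg2pi_in_interval_iff[OF that True]
        by (simp add: w_def \<tau>_def indicator_def)
    next
      case False
      then have "poly p z \<notin> cis ` {a<..b}" by auto
      with False show ?thesis by (simp add: w_def indicator_def)
    qed
    then show ?thesis by (simp add: eM)
  qed
  have "emeasure M {0<..<2*pi} = emeasure N {0<..<2*pi}"
  proof (rule measures_eq_open_interval_finite_exceptions[OF sM sN S])
    fix x :: real
    have x: "{x} \<in> sets borel" by simp
    \<comment> \<open>The crude factor \<open>\<infinity>\<close> does no harm: the fibre is finite,
      hence null, and \<open>\<infinity> * 0 = 0\<close>.\<close>
    have "emeasure M {x} \<le> (\<integral>\<^sup>+z. \<infinity> * indicator {z. poly p z = cis x} z \<partial>arc_length)"
      unfolding eM[OF x]
    proof (intro nn_integral_mono)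
      fix z
      show "w z * indicator (\<tau> -` {x}) z \<le> \<infinity> * indicator {z. poly p z = cis x} z"
      proof (cases "cmod (poly p z) = 1 \<and> Arg2pi (poly p z) = x")
        case True
        then have "poly p z = cis x" by (metis complex_norm_eq_1_exp cis_conv_exp)
        then show ?thesis by simp
      next
        case False
        then have "w z * indicator (\<tau> -` {x}) z = 0" by (auto simp: w_def \<tau>_def indicator_def)
        then show ?thesis by (simp only: zero_le)
      qed
    qed
    also have "\<dots> = 0"
      using finite_null_arc_length[OF card_preimage_poly(1)[OF deg], of "cis x"]
      by (subst nn_integral_cmult_indicator) auto
    finally have "emeasure M {x} = 0" by simp
    moreover have "emeasure N {x} = 0"
    proof -
      have "AE t in lborel. t \<notin> {x}" by (rule AE_not_in) (simp add: finite_imp_null_set_lborel)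
      then have "emeasure N {x} = (\<integral>\<^sup>+t. 0 \<partial>lborel)"
        by (subst eN, simp) (auto intro!: nn_integral_cong_AE elim!: eventually_mono)
      then show ?thesis by simp
    qed
    ultimately show "emeasure M {x} = emeasure N {x}" by simp
  next
    fix c d assume cd: "0 < c" "c \<le> d" "d < 2*pi" "{c..d} \<inter> S = {}"
    show "emeasure M {c<..d} = emeasure N {c<..d}"
    proof (rule measures_eq_interval_local[OF sM sN cd(2)])
      fix t e :: real assume t: "c \<le> t" "t \<le> d" and e: "e > 0"
      have tQ: "t \<in> Q" using t cd by (auto simp: Q_def)
      from local[OF tQ e] obtain \<delta> where \<delta>: "\<delta> > 0" "\<And>s. \<bar>s - t\<bar> < \<delta> \<Longrightarrow> \<bar>G s - G t\<bar> \<le> e"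
        and est: "\<And>a b. a \<le> t \<Longrightarrow> t \<le> b \<Longrightarrow> b - a < \<delta> \<Longrightarrow>
          ennreal ((G t - e) * (b - a)) \<le> (\<integral>\<^sup>+z. ennreal (f z * cmod (poly (pderiv p) z)) *
             indicator {z. poly p z \<in> cis ` {a<..b}} z \<partial>arc_length) \<and>
          (\<integral>\<^sup>+z. ennreal (f z * cmod (poly (pderiv p) z)) *
             indicator {z. poly p z \<in> cis ` {a<..b}} z \<partial>arc_length) \<le> ennreal ((G t + e) * (b - a))"
        by (elim exE conjE) blast
      \<comment> \<open>Keeps \<open>{a..b}\<close> inside \<open>Q\<close>, so that the angle is
        faithful on it and \<open>g\<close> coincides with \<open>G\<close> there.\<close>
      obtain \<delta>' where \<delta>': "\<delta>' > 0" "ball t \<delta>' \<subseteq> Q" using Qopen tQ open_contains_ball by blast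
      have "ennreal ((G t - e) * (b - a)) \<le> emeasure K {a<..b} \<and>
            emeasure K {a<..b} \<le> ennreal ((G t + e) * (b - a))"
        if ab: "a \<le> t \<and> t \<le> b \<and> b - a < min \<delta> \<delta>'" and K: "K \<in> {M, N}" for a b K
      proof -
        have sub: "{a..b} \<subseteq> Q"
        proof
          fix s assume "s \<in> {a..b}"
          then have "s \<in> ball t \<delta>'" using ab by (auto simp: dist_real_def)
          then show "s \<in> Q" using \<delta>' by blast
        qed
        then have a0: "0 \<le> a" "b < 2*pi" using ab by (auto simp: Q_def subset_iff less_imp_le)
        have M_est: "ennreal ((G t - e) * (b - a)) \<le> emeasure M {a<..b} \<and>
            emeasure M {a<..b} \<le> ennreal ((G t + e) * (b - a))"
          unfolding eM_int[OF a0] using est[of a b] ab by simp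
        have close: "G s \<le> G t + e" "G t - e \<le> G s" if "s \<in> {a<..b}" for s
        proof -
          have "\<bar>s - t\<bar> < \<delta>" using that ab by auto
          from \<delta>(2)[OF this] show "G s \<le> G t + e" "G t - e \<le> G s" by linarith+
        qed
        have J: "{a<..b} \<in> sets borel" by simp
        have gs: "g s * indicator {a<..b} s = ennreal (G s) * indicator {a<..b} s" for s
          using subsetD[OF sub, of s] by (auto simp: g_def split: split_indicator)
        have cst: "(\<integral>\<^sup>+s. ennreal k * indicator {a<..b} s \<partial>lborel) = ennreal (k * (b - a))" for k
          using ab by (subst nn_integral_cmult_indicator) (auto simp: ennreal_mult'')
        have "emeasure N {a<..b} \<le> (\<integral>\<^sup>+s. ennreal (G t + e) * indicator {a<..b} s \<partial>lborel)"
          unfolding eN[OF J] gs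
          by (intro nn_integral_mono) (use close in \<open>auto intro!: ennreal_leI split: split_indicator\<close>)
        moreover have "(\<integral>\<^sup>+s. ennreal (G t - e) * indicator {a<..b} s \<partial>lborel) \<le> emeasure N {a<..b}"
          unfolding eN[OF J] gs
          by (intro nn_integral_mono) (use close in \<open>auto intro!: ennreal_leI split: split_indicator\<close>)
        ultimately show ?thesis using M_est K unfolding cst by blast
      qed
      then show "\<exists>r. \<exists>\<delta>>0. \<forall>a b. a \<le> t \<and> t \<le> b \<and> b - a < \<delta> \<longrightarrow>
        (\<forall>K\<in>{M, N}. ennreal ((r - e) * (b - a)) \<le> emeasure K {a<..b} \<and>
                     emeasure K {a<..b} \<le> ennreal ((r + e) * (b - a)))"
        using \<delta>(1) \<delta>'(1) by (intro exI[of _ "G t"] exI[of _ "min \<delta> \<delta>'"] conjI allI impI ballI) simp_all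
    qed
  qed
  moreover have "emeasure N {0<..<2*pi} = (\<integral>\<^sup>+t. g t \<partial>lborel)"
    by (subst eN) (auto intro!: nn_integral_cong simp: g_def Q_def split: split_indicator)
  moreover have "emeasure M {0<..<2*pi} = (\<integral>\<^sup>+z. w z \<partial>arc_length)"
  proof (subst eM)
    \<comment> \<open>The open interval omits the angle 0, whose fibre is finite and therefore
      null.\<close>
    have "AE z in arc_length. z \<notin> {z. poly p z = 1}"
      by (intro AE_not_in finite_null_arc_length card_preimage_poly(1) deg)
    then show "(\<integral>\<^sup>+z. w z * indicator (\<tau> -` {0<..<2*pi}) z \<partial>arc_length) = (\<integral>\<^sup>+z. w z \<partial>arc_length)"
    proof (intro nn_integral_cong_AE, eventually_elim)
      fix z assume z: "z \<notin> {z. poly p z = 1}"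
      have "\<tau> z \<in> {0<..<2*pi}" if "cmod (poly p z) = 1"
      proof -
        have "Arg2pi (poly p z) \<noteq> 0"
          using z that by (metis complex_norm_eq_1_exp exp_zero mem_Collect_eq mult_zero_right of_real_0)
        moreover have "0 \<le> Arg2pi (poly p z)" "Arg2pi (poly p z) < 2*pi" using Arg2pi[of "poly p z"] by auto
        ultimately show ?thesis by (simp add: \<tau>_def)
      qed
      then show "w z * indicator (\<tau> -` {0<..<2*pi}) z = w z"
        by (auto simp: w_def split: split_indicator)
    qed
  qed simp
  ultimately show ?thesis by (simp add: w_def g_def Q_def)
qed

section \<open>Jensen's formula for a linear factor\<close>

text \<open>Cauchy's integral formula at 0 for \<open>Ln (1 - a * z)\<close>, which is holomorphic
  on the closed disc since \<open>Re (a * z) < 1\<close> there, and which vanishes at 0. The real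
  part is the claim.\<close>

lemma ln_cmod_mean_value:
  assumes a: "cmod a < 1"
  shows "((\<lambda>t. ln (cmod (1 - a * cis t))) has_integral 0) {0..2*pi}"
proof -
  define F where "F z = Ln (1 - a * z)" for z
  have small: "cmod (a * z) < 1" if "cmod z \<le> 1" for z
    using a that by (metis mult_left_le norm_ge_zero norm_mult order_le_less_trans)
  have nz: "1 - a * z \<notin> \<real>\<^sub>\<le>\<^sub>0" if "cmod z \<le> 1" for z
  proof -
    have "Re (a * z) < 1" using small[OF that] complex_Re_le_cmod[of "a * z"] by linarith
    then show ?thesis by (auto simp: complex_nonpos_Reals_iff)
  qed
  have hol: "F holomorphic_on cball 0 1"
    unfolding F_def by (intro holomorphic_intros) (use nz in auto)
  have "((\<lambda>u. F u / (u - 0)) has_contour_integral (2 * of_real pi * \<i> * F 0)) (circlepath 0 1)"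
    using hol by (intro Cauchy_integral_circlepath)
      (auto intro: holomorphic_on_imp_continuous_on holomorphic_on_subset)
  then have "((\<lambda>x. F (circlepath 0 1 x) / circlepath 0 1 x *
              vector_derivative (circlepath 0 1) (at x within {0..1})) has_integral 0) {0..1}"
    by (simp add: has_contour_integral_def F_def)
  then have "((\<lambda>x. 2 * pi * \<i> * F (cis (2 * pi * x))) has_integral 0) {0..1}"
  proof (rule has_integral_eq[rotated])
    fix x :: real assume "x \<in> {0..1}"
    then have vd: "vector_derivative (circlepath 0 1) (at x within {0..1}) = 2 * pi * \<i> * cis (2 * pi * x)"
      by (simp add: vector_derivative_circlepath01 cis_conv_exp mult_ac)
    have "circlepath 0 1 x = cis (2 * pi * x)"
      by (simp add: circlepath cis_conv_exp mult_ac)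
    then show "F (circlepath 0 1 x) / circlepath 0 1 x *
        vector_derivative (circlepath 0 1) (at x within {0..1}) = 2 * pi * \<i> * F (cis (2 * pi * x))"
      unfolding vd by simp
  qed
  from has_integral_mult_right[OF this, of "1 / (2 * pi * \<i>)"]
  have "((\<lambda>x. F (cis (2 * pi * x))) has_integral 0) {0..1}" by simp
  from has_integral_Re[OF this]
  have "((\<lambda>x. Re (F (cis (2 * pi * x)))) has_integral 0) {0..1}" by simp
  then have "((\<lambda>x. ln (cmod (1 - a * cis (2 * pi * x)))) has_integral 0) {0..1}"
  proof (rule has_integral_eq[rotated], goal_cases)
    case (1 x)
    have "1 - a * cis (2 * pi * x) \<noteq> 0" using nz[of "cis (2 * pi * x)"] by auto
    then show ?case by (simp add: F_def)
  qed
  from has_integral_stretch_real[OF this, of "1 / (2 * pi)"]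
  show ?thesis
    using image_mult_atLeastAtMost[of "2 * pi" 0 1] by (simp add: mult.commute)
qed

lemma cis_eq_finite: "finite {t \<in> {0..2*pi}. cis t = w}"
proof -
  have "{t \<in> {0..2*pi}. cis t = w} \<subseteq> insert (2*pi) (Arg2pi ` {w})"
  proof
    fix t assume "t \<in> {t \<in> {0..2*pi}. cis t = w}"
    then have "t = 2 * pi \<or> Arg2pi w = t"
      by (auto simp: cis_conv_exp intro!: Arg2pi_unique[of 1])
    then show "t \<in> insert (2*pi) (Arg2pi ` {w})" by auto
  qed
  then show ?thesis using finite_subset by blast
qed

text \<open>Factor \<open>w - cis t = w * (1 - 1 / w * cis t)\<close>; the second factor has mean
  logarithm 0.\<close>

lemma jensen_outside:
  assumes w: "cmod w > 1"
  shows "((\<lambda>t. ln (cmod (w - cis t))) has_integral 2 * pi * ln (cmod w)) {0..2*pi}"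
proof -
  have "cmod (1 / w) < 1" using w by (simp add: norm_divide divide_less_eq)
  from has_integral_add[OF ln_cmod_mean_value[OF this] has_integral_const_real[of "ln (cmod w)" 0 "2*pi"]]
  have "((\<lambda>t. ln (cmod (1 - 1 / w * cis t)) + ln (cmod w)) has_integral 2 * pi * ln (cmod w)) {0..2*pi}"
    by simp
  then show ?thesis
  proof (rule has_integral_eq[rotated])
    fix t
    have w0: "w \<noteq> 0" using w by auto
    have "w \<noteq> cis t" using w by auto
    then have "cmod (1 - 1 / w * cis t) \<noteq> 0" using w0 by (simp add: field_simps)
    moreover have "w - cis t = w * (1 - 1 / w * cis t)" using w0 by (simp add: field_simps)
    ultimately show "ln (cmod (1 - 1 / w * cis t)) + ln (cmod w) = ln (cmod (w - cis t))"
      using w0 by (simp add: norm_mult ln_mult)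
  qed
qed

text \<open>On the circle, conjugation and multiplication by \<open>- cis t\<close> preserve the
  modulus and turn \<open>w - cis t\<close> into \<open>1 - cnj w * cis t\<close>.\<close>

lemma jensen_inside:
  assumes w: "cmod w < 1"
  shows "((\<lambda>t. ln (cmod (w - cis t))) has_integral 0) {0..2*pi}"
proof -
  have "cmod (w - cis t) = cmod (1 - cnj w * cis t)" for t
  proof -
    have "cmod (w - cis t) = cmod (cnj (w - cis t))" by (simp only: complex_mod_cnj)
    also have "\<dots> = cmod (- cis t * cnj (w - cis t))" by (simp add: norm_mult del: complex_cnj_diff)
    also have "- cis t * cnj (w - cis t) = 1 - cnj w * cis t"
      by (simp add: algebra_simps cis_cnj cis_mult)
    finally show ?thesis .
  qed
  then show ?thesis using ln_cmod_mean_value[of "cnj w"] w by simp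
qed

text \<open>
  On the circle we approach \<open>w\<close> along \<open>r * w\<close> with \<open>r\<close> decreasing to 1: for \<open>|w| = |u| = 1\<close>,
  \<open>|r * w - u|\<^sup>2 / r = (r - 1)\<^sup>2 / r + |w - u|\<^sup>2\<close> decreases to \<open>|w - u|\<^sup>2\<close>.
\<close>

lemma jensen_on_circle:
  assumes w: "cmod w = 1"
  shows "((\<lambda>t. ln (cmod (w - cis t))) has_integral 0) {0..2*pi}"
proof -
  \<comment> \<open>Where \<open>cis t = w\<close> the approximants tend to minus infinity while the
    limit function takes the default \<open>ln 0 = 0\<close>, so these angles are removed.\<close>
  define S where "S = {0..2*pi} - {t \<in> {0..2*pi}. cis t = w}"
  define r where "r k = 1 + 1 / (real k + 1)" for k :: nat
  \<comment> \<open>Half the logarithm of the decreasing quantity; the correction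
    \<open>ln (r k) / 2\<close> tends to 0 and leaves the limit unchanged.\<close>
  define f where "f k t = ln (cmod (of_real (r k) * w - cis t)) - ln (r k) / 2" for k t
  have r1: "r k > 1" for k by (simp add: r_def add_pos_nonneg)
  have r_dec: "r (Suc k) \<le> r k" for k by (simp add: r_def frac_le)
  have r_lim: "r \<longlonglongrightarrow> 1"
  proof -
    have "(\<lambda>k. 1 + 1 / real (Suc k)) \<longlonglongrightarrow> 1 + 0"
      by (intro tendsto_intros LIMSEQ_Suc[OF lim_1_over_n])
    then show ?thesis by (simp add: r_def[abs_def] add.commute)
  qed
  have sq: "(cmod (of_real R * w - cis t))\<^sup>2 = (R - 1)\<^sup>2 + R * (cmod (w - cis t))\<^sup>2" for R t
  proof -
    have a: "(Re w)\<^sup>2 + (Im w)\<^sup>2 = 1" using w by (simp add: cmod_def)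
    have b: "(cos t)\<^sup>2 + (sin t)\<^sup>2 = 1" by simp
    have "(R * Re w - cos t)\<^sup>2 + (R * Im w - sin t)\<^sup>2 =
            (R - 1)\<^sup>2 + R * ((Re w - cos t)\<^sup>2 + (Im w - sin t)\<^sup>2)"
      using a b by algebra
    then show ?thesis unfolding cmod_power2 by simp
  qed
  have f_eq: "f k t = ln ((r k - 1)\<^sup>2 / r k + (cmod (w - cis t))\<^sup>2) / 2" if "cis t \<noteq> w" for k t
  proof -
    have pos: "cmod (of_real (r k) * w - cis t) > 0"
    proof -
      have "(cmod (of_real (r k) * w - cis t))\<^sup>2 > 0"
        unfolding sq using r1[of k] by (intro add_pos_nonneg) auto
      then show ?thesis by auto
    qed
    then have "2 * f k t = ln ((cmod (of_real (r k) * w - cis t))\<^sup>2) - ln (r k)"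
      by (simp add: f_def ln_realpow)
    also have "\<dots> = ln ((cmod (of_real (r k) * w - cis t))\<^sup>2 / r k)"
      using pos r1[of k] by (simp add: ln_div)
    also have "(cmod (of_real (r k) * w - cis t))\<^sup>2 / r k = (r k - 1)\<^sup>2 / r k + (cmod (w - cis t))\<^sup>2"
      unfolding sq using r1[of k] by (simp add: add_divide_distrib)
    finally show ?thesis by simp
  qed
  have negl: "negligible {t \<in> {0..2*pi}. cis t = w}"
    by (intro negligible_finite cis_eq_finite)
  have sw: "(h has_integral I) S \<longleftrightarrow> (h has_integral I) {0..2*pi}" for h :: "real \<Rightarrow> real" and I
    unfolding S_def by (rule has_integral_spike_set_eq) (auto intro: negligible_subset[OF negl])
  have int_f: "(f k has_integral pi * ln (r k)) S" for k
  proof -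
    have "cmod (of_real (r k) * w) = r k" using r1[of k] w by (simp add: norm_mult)
    with jensen_outside[of "of_real (r k) * w"] r1[of k]
    have "((\<lambda>t. ln (cmod (of_real (r k) * w - cis t))) has_integral 2 * pi * ln (r k)) {0..2*pi}" by simp
    from has_integral_diff[OF this has_integral_const_real[of "ln (r k) / 2" 0 "2*pi"]]
    show ?thesis unfolding sw f_def by (simp add: algebra_simps)
  qed
  have "(\<lambda>t. ln (cmod (w - cis t))) integrable_on S \<and>
        (\<lambda>k. integral S (f k)) \<longlonglongrightarrow> integral S (\<lambda>t. ln (cmod (w - cis t)))"
  proof (rule monotone_convergence_decreasing)
    show "f k integrable_on S" for k using int_f by blast
    have int_eq: "integral S (f k) = pi * ln (r k)" for k using int_f by blast
    show "bounded (range (\<lambda>k. integral S (f k)))"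
      unfolding int_eq
      by (rule convergent_imp_bounded[of _ "pi * ln 1"]) (intro tendsto_intros r_lim, simp)
    fix t assume t: "t \<in> S"
    then have ne: "cis t \<noteq> w" by (auto simp: S_def)
    then have pos: "cmod (w - cis t) > 0" by auto
    show "f (Suc k) t \<le> f k t" for k
    proof -
      have "(r (Suc k) - 1)\<^sup>2 / r (Suc k) \<le> (r k - 1)\<^sup>2 / r k"
      proof -
        define a b where "a = r (Suc k)" and "b = r k"
        have ab: "1 < a" "a \<le> b" using r1 r_dec by (auto simp: a_def b_def)
        have "1 * 1 \<le> a * b" using ab by (intro mult_mono) auto
        \<comment> \<open>This product equals
          \<open>(b - 1)\<^sup>2 * a - (a - 1)\<^sup>2 * b\<close>.\<close>
        then have "0 \<le> (b - a) * (a * b - 1)" using ab by (intro mult_nonneg_nonneg) auto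
        then have "(a - 1)\<^sup>2 * b \<le> (b - 1)\<^sup>2 * a"
          by (simp add: algebra_simps power2_eq_square)
        then show ?thesis using ab by (simp add: divide_simps mult.commute flip: a_def b_def)
      qed
      then show ?thesis
        unfolding f_eq[OF ne] using pos r1[of "Suc k"] r1[of k]
        by (intro divide_right_mono) (auto intro!: ln_mono add_nonneg_pos divide_nonneg_pos)
    qed
    have "(\<lambda>k. ln ((r k - 1)\<^sup>2 / r k + (cmod (w - cis t))\<^sup>2) / 2) \<longlonglongrightarrow>
            ln ((1 - 1)\<^sup>2 / 1 + (cmod (w - cis t))\<^sup>2) / 2"
      using pos by (intro tendsto_intros r_lim) auto
    then show "(\<lambda>k. f k t) \<longlonglongrightarrow> ln (cmod (w - cis t))"
      unfolding f_eq[OF ne] using pos by (simp add: ln_realpow)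
  qed
  moreover have "(\<lambda>k. integral S (f k)) \<longlonglongrightarrow> 0"
  proof -
    have "(\<lambda>k. pi * ln (r k)) \<longlonglongrightarrow> pi * ln 1" by (intro tendsto_intros r_lim) auto
    then show ?thesis unfolding integral_unique[OF int_f] by simp
  qed
  ultimately have "((\<lambda>t. ln (cmod (w - cis t))) has_integral 0) S"
    by (metis LIMSEQ_unique integrable_integral)
  then show ?thesis by (simp add: sw)
qed

text \<open>The gauge integral becomes a Lebesgue integral because
  \<open>ln (cmod w + 1) - ln (cmod (w - cis t))\<close> is nonnegative, and for nonnegative
  functions integrability is absolute.\<close>

lemma jensen_linear:
  "has_bochner_integral lborel (\<lambda>t. indicator {0<..<2*pi} t *\<^sub>R ln (cmod (w - cis t)))
     (2 * pi * ln (max 1 (cmod w)))"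
proof -
  let ?h = "\<lambda>t. ln (cmod (w - cis t))"
  have hi: "(?h has_integral 2 * pi * ln (max 1 (cmod w))) {0..2*pi}"
    using jensen_outside[of w] jensen_inside[of w] jensen_on_circle[of w]
    by (cases "cmod w" "1::real" rule: linorder_cases) (auto simp: max_def)
  have hc: "((\<lambda>t. ln (cmod w + 1) - ?h t) has_integral
              2 * pi * ln (cmod w + 1) - 2 * pi * ln (max 1 (cmod w))) {0..2*pi}"
    using has_integral_diff[OF has_integral_const_real[of "ln (cmod w + 1)" 0 "2*pi"] hi] by simp
  have "(\<lambda>t. ln (cmod w + 1) - ?h t) absolutely_integrable_on {0..2*pi}"
  proof (rule nonnegative_absolutely_integrable_1)
    fix t
    have "cmod (w - cis t) \<le> cmod w + 1" using norm_triangle_ineq4[of w "cis t"] by simp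
    then show "0 \<le> ln (cmod w + 1) - ?h t"
      by (cases "w = cis t") (auto intro!: ln_mono simp: add_nonneg_pos)
  qed (use hc in blast)
  then have "(\<lambda>t. ln (cmod w + 1) - (ln (cmod w + 1) - ?h t)) absolutely_integrable_on {0..2*pi}"
    using set_integral_diff(1)[OF absolutely_integrable_continuous_real[OF continuous_on_const]] by blast
  then have abs: "?h absolutely_integrable_on {0..2*pi}" by simp
  then have abs': "?h absolutely_integrable_on {0<..<2*pi}"
    by (rule set_integrable_subset) auto
  have meas: "?h \<in> borel_measurable borel"
    by (intro borel_measurable_ln borel_measurable_norm borel_measurable_diff) 
       (auto intro!: borel_measurable_continuous_onI continuous_intros)
  have int: "integrable lborel (\<lambda>t. indicator {0<..<2*pi} t *\<^sub>R ?h t)"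
    using abs' meas unfolding set_integrable_def
    by (subst (asm) integrable_completion) auto
  have "(?h has_integral 2 * pi * ln (max 1 (cmod w))) {0<..<2*pi}"
    using hi by (simp only: has_integral_Icc_iff_Ioo)
  moreover have "(?h has_integral (LINT t|lborel. indicator {0<..<2*pi} t *\<^sub>R ?h t)) {0<..<2*pi}"
    using has_integral_set_lebesgue[OF abs'] meas
    by (simp add: set_lebesgue_integral_def integral_completion)
  ultimately show ?thesis
    using int has_integral_unique by (auto simp: has_bochner_integral_iff)
qed

section \<open>The generalized Mahler measure\<close>

text \<open>The change of variables with the normalization \<open>1 / (2 * pi * m)\<close> included.
  The function \<open>g\<close> has to match the fibre sum only off \<open>S\<close>, so that a
  closed formula can be inserted for it.\<close>

lemma has_bochner_integral_lemniscate_measure: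
  fixes V :: "int poly" and f :: "complex \<Rightarrow> real" and g :: "real \<Rightarrow> real" and S :: "real set"
  defines "p \<equiv> cpoly V"
  assumes deg: "degree V > 0" and nonneg: "\<And>z. f z \<ge> 0" and meas: "f \<in> borel_measurable borel"
    and S: "finite S"
    and regular: "\<And>t z. t \<in> {0<..<2*pi} - S \<Longrightarrow> poly p z = cis t \<Longrightarrow> poly (pderiv p) z \<noteq> 0"
      "\<And>t z. t \<in> {0<..<2*pi} - S \<Longrightarrow> poly p z = cis t \<Longrightarrow> isCont f z"
    and g: "\<And>t. t \<in> {0<..<2*pi} - S \<Longrightarrow> g t = (\<Sum>z | poly p z = cis t. f z)"
    and I: "has_bochner_integral lborel (\<lambda>t. indicator {0<..<2*pi} t *\<^sub>R g t) I"
  shows "has_bochner_integral (lemniscate_measure V) f (I / (2 * pi * degree V))"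
proof (rule has_bochner_integral_nn_integral)
  define G where "G s = (\<Sum>z | poly p z = cis s. f z)" for s
  define c where "c = 1 / (2 * pi * real (degree V))"
  have c: "c \<ge> 0" by (simp add: c_def)
  have deg': "degree p > 0" using deg by (simp add: p_def)
  have L: "lemniscate V \<in> sets borel"
    unfolding lemniscate_def by (intro borel_closed closed_Collect_eq continuous_intros)
  have sets_r: "sets (restrict_space arc_length (lemniscate V)) = sets (restrict_space borel (lemniscate V))"
    by (rule sets_restrict_space_cong) simp
  have meas_r: "h \<in> borel_measurable (restrict_space arc_length (lemniscate V))"
    if "h \<in> borel_measurable borel" for h :: "complex \<Rightarrow> 'b::topological_space"
    using measurable_restrict_space1[OF that] by (simp add: measurable_cong_sets[OF sets_r refl])
  have den: "(\<lambda>z. ennreal (cmod (poly (pderiv p) z) / (2 * pi * real (degree V)))) \<in> borel_measurable borel"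
    using borel_measurable_poly by simp
  show fm: "f \<in> borel_measurable (lemniscate_measure V)"
    unfolding lemniscate_measure_def using meas_r[OF meas] by simp
  show "AE z in lemniscate_measure V. 0 \<le> f z" using nonneg by simp
  have AE_S: "AE t in lborel. t \<notin> S"
    by (intro AE_not_in) (simp add: S finite_imp_null_set_lborel)
  have AE_nonneg: "AE t in lborel. 0 \<le> indicator {0<..<2*pi} t *\<^sub>R g t"
    using AE_S by eventually_elim (auto simp: g sum_nonneg nonneg split: split_indicator)
  have int: "integrable lborel (\<lambda>t. indicator {0<..<2*pi} t *\<^sub>R g t)"
    and Ieq: "(LINT t|lborel. indicator {0<..<2*pi} t *\<^sub>R g t) = I"
    using I by (auto simp: has_bochner_integral_iff)
  have I0: "I \<ge> 0" using integral_nonneg_AE[OF AE_nonneg] Ieq by simp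
  then show "0 \<le> I / (2 * pi * degree V)" by simp
  have "(\<integral>\<^sup>+z. ennreal (f z) \<partial>lemniscate_measure V) =
     (\<integral>\<^sup>+z. ennreal (cmod (poly (pderiv p) z) / (2 * pi * real (degree V))) * ennreal (f z) * indicator (lemniscate V) z \<partial>arc_length)"
    unfolding lemniscate_measure_def p_def[symmetric] using L meas_r[OF den] meas_r[OF meas]
    by (simp add: nn_integral_density nn_integral_restrict_space)
  also have "\<dots> = (\<integral>\<^sup>+z. ennreal c * (ennreal (f z * cmod (poly (pderiv p) z)) * indicator {z. cmod (poly p z) = 1} z) \<partial>arc_length)"
    using nonneg c
    by (intro nn_integral_cong) (auto simp: lemniscate_def p_def c_def mult_ac simp flip: ennreal_mult split: split_indicator)
  also have "\<dots> = ennreal c * (\<integral>\<^sup>+z. ennreal (f z * cmod (poly (pderiv p) z)) * indicator {z. cmod (poly p z) = 1} z \<partial>arc_length)"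
  proof (rule nn_integral_cmult)
    have "{z. cmod (poly p z) = 1} \<in> sets borel" using L by (simp add: lemniscate_def p_def)
    then show "(\<lambda>z. ennreal (f z * cmod (poly (pderiv p) z)) * indicator {z. cmod (poly p z) = 1} z)
        \<in> borel_measurable arc_length"
      using meas borel_measurable_poly by (simp cong: measurable_cong_sets)
  qed
  also have "(\<integral>\<^sup>+z. ennreal (f z * cmod (poly (pderiv p) z)) * indicator {z. cmod (poly p z) = 1} z \<partial>arc_length)
      = (\<integral>\<^sup>+t. ennreal (G t) * indicator ({0<..<2*pi} - S) t \<partial>lborel)"
    unfolding G_def by (rule nn_integral_lemniscate[OF deg' nonneg meas S regular])
  also have "\<dots> = (\<integral>\<^sup>+t. ennreal (indicator {0<..<2*pi} t *\<^sub>R g t) \<partial>lborel)"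
    using AE_S by (intro nn_integral_cong_AE, eventually_elim) (auto simp: g G_def split: split_indicator)
  also have "\<dots> = ennreal I"
    using nn_integral_eq_integral[OF int AE_nonneg] Ieq by simp
  also have "ennreal c * ennreal I = ennreal (I / (2 * pi * degree V))"
    using c I0 by (simp add: c_def flip: ennreal_mult)
  finally show "(\<integral>\<^sup>+z. ennreal (f z) \<partial>lemniscate_measure V) = ennreal (I / (2 * pi * degree V))" .
qed

text \<open>A nonconstant \<open>V\<close> exceeds 1 in modulus outside some disc, so the lemniscate
  lies in that disc.\<close>

lemma lemniscate_poly_bounded:
  assumes "degree V > 0"
  obtains C where "\<And>z. z \<in> lemniscate V \<Longrightarrow> cmod (poly q z) \<le> C"
proof -
  obtain a p' where p': "cpoly V = pCons a p'" by (cases "cpoly V")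
  have "p' \<noteq> 0"
  proof
    assume "p' = 0"
    then have "degree (cpoly V) = 0" by (simp add: p')
    then show False using assms by simp
  qed
  then obtain r where r: "\<And>z. r \<le> cmod z \<Longrightarrow> 2 \<le> cmod (poly (cpoly V) z)"
    using poly_infinity[of p' 2 a] p' by auto
  obtain C where "\<And>z. cmod z \<le> r \<Longrightarrow> cmod (poly q z) \<le> C"
    using poly_bound_exists[of r q] by blast
  moreover have "cmod z \<le> r" if "z \<in> lemniscate V" for z
    using r[of z] that by (force simp: lemniscate_def)
  ultimately show ?thesis using that by blast
qed

text \<open>
  The left-hand side is \<open>ln |Res(p - w, P)|\<close>; expanding the resultant along the roots of \<open>P\<close>
  instead of those of \<open>p - w\<close> gives the right-hand side.
\<close>

lemma sum_ln_over_fibre: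
  fixes p P :: "complex poly" and w :: complex and root :: "nat \<Rightarrow> complex"
  assumes lc: "lead_coeff p = 1" and deg: "degree p > 0" and a: "a \<noteq> 0"
    and P: "P = smult a (\<Prod>i<n. [:- root i, 1:])"
    and regular: "\<And>z. poly p z = w \<Longrightarrow> poly (pderiv p) z \<noteq> 0" "\<And>i. i < n \<Longrightarrow> poly p (root i) \<noteq> w"
  shows "(\<Sum>z | poly p z = w. ln (cmod (poly P z))) =
         degree p * ln (cmod a) + (\<Sum>i<n. ln (cmod (poly p (root i) - w)))"
proof -
  define Z where "Z = {z. poly p z = w}"
  have Z: "finite Z" "card Z = degree p"
    using card_preimage_poly[OF deg, of w] regular(1) by (auto simp: Z_def)
  have d: "degree (p - [:w:]) = degree p" using deg by (rule degree_minus_const_poly)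
  have lc': "lead_coeff (p - [:w:]) = 1" using lc deg unfolding d by (simp add: coeff_pCons split: nat.split)
  have "rsquarefree (p - [:w:])"
    unfolding rsquarefree_roots using regular(1) by (auto simp: pderiv_diff pderiv_pCons)
  from complex_poly_decompose_rsquarefree[OF this] lc'
  \<comment> \<open>Monic and with simple roots at a regular value: evaluating at
    \<open>root i\<close> turns a product over the fibre into \<open>p (root i) - w\<close>.\<close>
  have "(\<Prod>z\<in>Z. [:-z, 1:]) = p - [:w:]" by (simp add: Z_def)
  then have val: "poly p x - w = (\<Prod>z\<in>Z. x - z)" for x
    by (metis (no_types, lifting) poly_prod poly_diff prod.cong poly_pCons poly_0 mult_zero_right
        add.right_neutral mult_1_right uminus_add_conv_diff)
  have nz: "z \<noteq> root i" if "z \<in> Z" "i < n" for z i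
    using regular(2)[OF that(2)] that(1) by (auto simp: Z_def)
  have "(\<Sum>z\<in>Z. ln (cmod (poly P z))) = (\<Sum>z\<in>Z. ln (cmod a) + (\<Sum>i<n. ln (cmod (root i - z))))"
  proof (rule sum.cong)
    fix z assume z: "z \<in> Z"
    have "cmod (poly P z) = cmod a * (\<Prod>i<n. cmod (root i - z))"
      by (simp add: P poly_prod norm_mult prod_norm[symmetric] norm_minus_commute)
    moreover have "ln (\<Prod>i<n. cmod (root i - z)) = (\<Sum>i<n. ln (cmod (root i - z)))"
      using nz[OF z] by (intro ln_prod) force+
    moreover have "(\<Prod>i<n. cmod (root i - z)) > 0" using nz[OF z] by (intro prod_pos) force
    ultimately show "ln (cmod (poly P z)) = ln (cmod a) + (\<Sum>i<n. ln (cmod (root i - z)))"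
      using a by (metis ln_mult_pos zero_less_norm_iff)
  qed simp
  also have "\<dots> = degree p * ln (cmod a) + (\<Sum>z\<in>Z. \<Sum>i<n. ln (cmod (root i - z)))"
    using Z by (simp add: sum.distrib)
  also have "(\<Sum>z\<in>Z. \<Sum>i<n. ln (cmod (root i - z))) = (\<Sum>i<n. \<Sum>z\<in>Z. ln (cmod (root i - z)))"
    by (rule sum.swap)
  also have "\<dots> = (\<Sum>i<n. ln (cmod (poly p (root i) - w)))"
  proof (rule sum.cong)
    fix i assume i: "i \<in> {..<n}"
    have "ln (\<Prod>z\<in>Z. cmod (root i - z)) = (\<Sum>z\<in>Z. ln (cmod (root i - z)))"
      using nz i Z(1) by (intro ln_prod) force+
    then show "(\<Sum>z\<in>Z. ln (cmod (root i - z))) = ln (cmod (poly p (root i) - w))"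
      by (simp add: val prod_norm)
  qed simp
  finally show ?thesis by (simp add: Z_def)
qed

text \<open>The logarithm of the product formula for \<open>M_L(P)\<close>. It follows by
  integrating the fibre sum of \<open>B - ln |P|\<close> over the angle, one linear Jensen term for
  each root of \<open>P\<close>, and subtracting from \<open>B\<close>.\<close>

lemma integral_ln_lemniscate:
  fixes V P :: "int poly" and root :: "nat \<Rightarrow> complex"
  assumes lcV: "lead_coeff V = 1" and degV: "degree V > 0" and P0: "P \<noteq> 0"
    and P: "cpoly P = smult (of_int (lead_coeff P)) (\<Prod>i<n. [:- root i, 1:])"
  shows "(LINT z|lemniscate_measure V. ln (cmod (poly (cpoly P) z))) =
     ln \<bar>lead_coeff P\<bar> + (\<Sum>i<n. ln (max 1 (cmod (poly (cpoly V) (root i))))) / degree V"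
proof -
  define p where "p = cpoly V"
  define m where "m = degree V"
  define a :: complex where "a = of_int (lead_coeff P)"
  have m: "m > 0" using degV by (simp add: m_def)
  have p: "degree p = m" "lead_coeff p = 1" "degree p > 0" using lcV degV by (simp_all add: p_def m_def coeff_map_poly)
  have a: "a \<noteq> 0" "cmod a = \<bar>real_of_int (lead_coeff P)\<bar>" using P0 by (auto simp: a_def)
  have root: "poly (cpoly P) z = 0 \<longleftrightarrow> (\<exists>i<n. z = root i)" for z
    by (subst P) (use a in \<open>auto simp: poly_prod a_def\<close>)
  \<comment> \<open>The exceptional values: critical values, where fibres degenerate, and the values
    of \<open>p\<close> at zeros of \<open>P\<close>, where \<open>ln |P|\<close> is
    discontinuous.\<close>
  define W where "W = poly p ` ({z. poly (pderiv p) z = 0} \<union> {z. poly (cpoly P) z = 0})"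
  have "pderiv p \<noteq> 0" using p by (simp add: pderiv_eq_0_iff)
  then have W: "finite W"
    using P0 unfolding W_def by (intro finite_imageI finite_UnI poly_roots_finite) auto
  define S where "S = (\<Union>w\<in>W. {t \<in> {0..2*pi}. cis t = w})"
  have S: "finite S" unfolding S_def using W cis_eq_finite by blast
  have not_W: "cis t \<notin> W" if "t \<in> {0<..<2*pi} - S" for t using that by (auto simp: S_def)
  have reg: "poly (pderiv p) z \<noteq> 0" "poly (cpoly P) z \<noteq> 0"
    if "t \<in> {0<..<2*pi} - S" "poly p z = cis t" for t z
    using not_W[OF that(1)] that(2) unfolding W_def by (force simp: image_iff)+
  have norm1: "z \<in> lemniscate V" if "poly p z = cis t" for z t
    using that by (simp add: lemniscate_def p_def)
  have const: "has_bochner_integral lborel (\<lambda>t. indicator {0<..<2*pi} t *\<^sub>R k) (2 * pi * k)" for k :: real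
    using has_bochner_integral_scaleR_left[OF has_bochner_integral_real_indicator[of "{0<..<2*pi}" lborel], of k]
    by simp
  obtain C where C: "\<And>z. z \<in> lemniscate V \<Longrightarrow> cmod (poly (cpoly P) z) \<le> C"
    using lemniscate_poly_bounded[OF degV] by blast
  \<comment> \<open>The maximum with 1 makes \<open>B \<ge> 0\<close>, so that \<open>B\<close> also
    dominates the default value \<open>ln 0 = 0\<close> at zeros of \<open>P\<close>.\<close>
  define B where "B = ln (max 1 C)"
  have B: "ln (cmod (poly (cpoly P) z)) \<le> B" if "z \<in> lemniscate V" for z
  proof (cases "poly (cpoly P) z = 0")
    case False
    then show ?thesis unfolding B_def using C[OF that] by (intro ln_mono) auto
  qed (simp add: B_def)
  \<comment> \<open>Clipping gives nonnegativity on the whole plane; on the lemniscate it changes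
    nothing.\<close>
  define f where "f z = max 0 (B - ln (cmod (poly (cpoly P) z)))" for z
  define g where "g t = m * B - (m * ln (cmod a) + (\<Sum>i<n. ln (cmod (poly p (root i) - cis t))))" for t
  define T where "T = (\<Sum>i<n. ln (max 1 (cmod (poly p (root i)))))"
  \<comment> \<open>Total mass 1: each regular fibre has \<open>m\<close> points. This restores the
    constant \<open>B\<close>.\<close>
  have one: "has_bochner_integral (lemniscate_measure V) (\<lambda>z. 1) (2 * pi * real m / (2 * pi * m))"
    unfolding m_def
  proof (rule has_bochner_integral_lemniscate_measure[OF degV _ _ S])
    fix t assume t: "t \<in> {0<..<2*pi} - S"
    show "real (degree V) = (\<Sum>z | poly (cpoly V) z = cis t. 1)"
      using card_preimage_poly(3)[OF p(3), of "cis t"] reg(1)[OF t] p(1) by (simp add: p_def m_def)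
  qed (use reg const in \<open>auto simp: p_def\<close>)
  have "has_bochner_integral (lemniscate_measure V) f (2 * pi * (m * B - m * ln (cmod a) - T) / (2 * pi * m))"
  proof (rule has_bochner_integral_lemniscate_measure[OF degV _ _ S, folded p_def m_def])
    show "f \<in> borel_measurable borel"
      unfolding f_def using borel_measurable_poly by simp
    show "isCont f z" if "t \<in> {0<..<2*pi} - S" "poly p z = cis t" for t z
      unfolding f_def using reg(2)[OF that] by (intro continuous_intros) auto
    show "g t = (\<Sum>z | poly p z = cis t. f z)" if t: "t \<in> {0<..<2*pi} - S" for t
    proof -
      have "(\<Sum>z | poly p z = cis t. f z) = (\<Sum>z | poly p z = cis t. B - ln (cmod (poly (cpoly P) z)))"
        using B norm1 by (intro sum.cong) (auto simp: f_def)
      also have "\<dots> = m * B - (\<Sum>z | poly p z = cis t. ln (cmod (poly (cpoly P) z)))"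
        using card_preimage_poly(3)[OF p(3), of "cis t"] reg(1)[OF t] p(1) by (simp add: sum_subtractf)
      also have "(\<Sum>z | poly p z = cis t. ln (cmod (poly (cpoly P) z))) =
          degree p * ln (cmod a) + (\<Sum>i<n. ln (cmod (poly p (root i) - cis t)))"
      proof (rule sum_ln_over_fibre[OF p(2,3) a(1)])
        show "cpoly P = smult a (\<Prod>i<n. [:- root i, 1:])" using P by (simp add: a_def)
        show "poly p (root i) \<noteq> cis t" if "i < n" for i
          using reg(2)[OF t, of "root i"] root[of "root i"] that by blast
      qed (use reg(1)[OF t] in blast)
      finally show ?thesis by (simp add: g_def p(1))
    qed
    have "has_bochner_integral lborel (\<lambda>t. indicator {0<..<2*pi} t *\<^sub>R (m * B) -
        (indicator {0<..<2*pi} t *\<^sub>R (m * ln (cmod a)) +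
         (\<Sum>i<n. indicator {0<..<2*pi} t *\<^sub>R ln (cmod (poly p (root i) - cis t)))))
      (2 * pi * (m * B) - (2 * pi * (m * ln (cmod a)) + (\<Sum>i<n. 2 * pi * ln (max 1 (cmod (poly p (root i)))))))"
      by (intro has_bochner_integral_diff has_bochner_integral_add has_bochner_integral_sum const jensen_linear)
    then show "has_bochner_integral lborel (\<lambda>t. indicator {0<..<2*pi} t *\<^sub>R g t)
        (2 * pi * (m * B - m * ln (cmod a) - T))"
      by (simp add: g_def T_def algebra_simps sum_distrib_left)
  qed (use reg in \<open>auto simp: f_def\<close>)
  from has_bochner_integral_diff[OF has_bochner_integral_mult_right[OF one, of B] this]
  have *: "has_bochner_integral (lemniscate_measure V) (\<lambda>z. B * 1 - f z)
      (B * (2 * pi * real m / (2 * pi * m)) - 2 * pi * (m * B - m * ln (cmod a) - T) / (2 * pi * m))"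
    by simp
  have "(LINT z|lemniscate_measure V. ln (cmod (poly (cpoly P) z))) = (LINT z|lemniscate_measure V. B * 1 - f z)"
  proof (rule Bochner_Integration.integral_cong)
    fix z assume "z \<in> space (lemniscate_measure V)"
    then have "z \<in> lemniscate V" by (simp add: lemniscate_measure_def space_restrict_space)
    from B[OF this] show "ln (cmod (poly (cpoly P) z)) = B * 1 - f z" by (simp add: f_def)
  qed simp
  also have "\<dots> = B * (2 * pi * real m / (2 * pi * m)) - 2 * pi * (m * B - m * ln (cmod a) - T) / (2 * pi * m)"
    using * by (rule has_bochner_integral_integral_eq)
  also have "\<dots> = ln (cmod a) + T / m" using m by (simp add: field_simps)
  finally show ?thesis by (simp add: a(2) T_def p_def m_def)
qed

text \<open>By the maximum modulus principle a nonconstant \<open>V\<close>, bounded by 1 near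
  \<open>z\<close>, cannot attain modulus 1 at \<open>z\<close>.\<close>

lemma interior_filled_lemniscate:
  assumes deg: "degree V > 0" and z: "z \<in> interior (filled_lemniscate V)"
  shows "cmod (poly (cpoly V) z) < 1"
proof (rule ccontr)
  assume "\<not> cmod (poly (cpoly V) z) < 1"
  then have "poly (cpoly V) constant_on UNIV"
    using z interior_subset[of "filled_lemniscate V"]
    by (intro maximum_modulus_principle[of _ _ "interior (filled_lemniscate V)" z])
       (force intro!: holomorphic_intros simp: filled_lemniscate_def)+
  then have "constant (poly (cpoly V))" by (auto simp: constant_on_def constant_def)
  then show False using constant_degree[of "cpoly V"] deg by simp
qed

theorem theorem2p1:
  fixes V :: "int poly"
  assumes "lead_coeff V = 1" and "degree V \<ge> 1"
  shows
    "(\<forall>P :: int poly. P \<noteq> 0 \<longrightarrow>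
        mahler_measure V P \<ge> 1 \<and>
        (mahler_measure V P = 1 \<longleftrightarrow>
           (lead_coeff P = 1 \<or> lead_coeff P = -1) \<and>
           (\<forall>z. poly (cpoly P) z = 0 \<longrightarrow> z \<in> filled_lemniscate V))) \<and>
     (\<forall>P :: int poly. lead_coeff P = 1 \<and> irreducible P \<longrightarrow>
        (mahler_measure V P = 1 \<longleftrightarrow>
           P dvd V \<or> (\<exists>\<Phi>. cyclotomic \<Phi> \<and> P dvd pcompose \<Phi> V))) \<and>
     (\<forall>\<alpha> :: complex. algebraic_int \<alpha> \<and> \<alpha> \<in> filled_lemniscate V \<and>
           conjugates \<alpha> \<subseteq> filled_lemniscate V \<longrightarrow>
        (\<alpha> \<in> interior (filled_lemniscate V) \<longrightarrow> poly (cpoly V) \<alpha> = 0) \<and>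
        (\<alpha> \<in> lemniscate V \<longrightarrow>
           (\<exists>\<Phi>. cyclotomic \<Phi> \<and> poly (cpoly (pcompose \<Phi> V)) \<alpha> = 0)))"
proof (intro conjI allI impI)
  have deg: "degree V > 0" using assms by simp
  have main: "mahler_measure V P \<ge> 1 \<and>
        (mahler_measure V P = 1 \<longleftrightarrow>
           (lead_coeff P = 1 \<or> lead_coeff P = -1) \<and>
           (\<forall>z. poly (cpoly P) z = 0 \<longrightarrow> z \<in> filled_lemniscate V))" if P0: "P \<noteq> 0" for P
  proof -
    define n where "n = degree P"
    obtain root :: "nat \<Rightarrow> complex" where root: "cpoly P = smult (of_int (lead_coeff P)) (\<Prod>i<n. [:- root i, 1:])"
      using complex_poly_decompose'[of "cpoly P"] unfolding n_def by (metis degree_of_int_poly lead_coeff_of_int_poly)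
    define h where "h i = ln (max 1 (cmod (poly (cpoly V) (root i))))" for i
    define b where "b = ln \<bar>real_of_int (lead_coeff P)\<bar>"
    have M: "mahler_measure V P = exp (b + (\<Sum>i<n. h i) / degree V)"
      unfolding mahler_measure_def b_def h_def integral_ln_lemniscate[OF assms(1) deg P0 root] by simp
    \<comment> \<open>Integrality enters here: a nonzero integer has modulus at least 1.\<close>
    have l1: "\<bar>real_of_int (lead_coeff P)\<bar> \<ge> 1"
    proof -
      have "lead_coeff P \<noteq> 0" using P0 by simp
      then show ?thesis by linarith
    qed
    have b0: "b \<ge> 0" using l1 by (simp add: b_def)
    have h0: "h i \<ge> 0" for i by (simp add: h_def)
    have s0: "(\<Sum>i<n. h i) \<ge> 0" by (intro sum_nonneg h0)
    \<comment> \<open>The exponent is a sum of nonnegative terms, so it vanishes only if each term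
      does.\<close>
    have "mahler_measure V P = 1 \<longleftrightarrow> b = 0 \<and> (\<Sum>i<n. h i) = 0"
      unfolding M using b0 s0 deg by (auto simp: add_nonneg_eq_0_iff)
    also have "b = 0 \<longleftrightarrow> lead_coeff P = 1 \<or> lead_coeff P = -1"
      using l1 by (auto simp: b_def abs_if split: if_splits)
    also have "(\<Sum>i<n. h i) = 0 \<longleftrightarrow> (\<forall>i<n. h i = 0)"
      using h0 by (subst sum_nonneg_eq_0_iff) auto
    also have "\<dots> \<longleftrightarrow> (\<forall>i<n. root i \<in> filled_lemniscate V)"
    proof -
      have "ln (max 1 x) = 0 \<longleftrightarrow> x \<le> 1" for x :: real by (auto simp: max_def)
      then show ?thesis by (simp add: h_def filled_lemniscate_def)
    qed
    also have "\<dots> \<longleftrightarrow> (\<forall>z. poly (cpoly P) z = 0 \<longrightarrow> z \<in> filled_lemniscate V)"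
      by (subst root) (use P0 in \<open>auto simp: poly_prod\<close>)
    finally show ?thesis using b0 s0 by (auto simp: M)
  qed
  then show "mahler_measure V P \<ge> 1" "mahler_measure V P = 1 \<longleftrightarrow>
           (lead_coeff P = 1 \<or> lead_coeff P = -1) \<and>
           (\<forall>z. poly (cpoly P) z = 0 \<longrightarrow> z \<in> filled_lemniscate V)" if "P \<noteq> 0" for P
    using that by blast+
  show "mahler_measure V P = 1 \<longleftrightarrow> P dvd V \<or> (\<exists>\<Phi>. cyclotomic \<Phi> \<and> P dvd pcompose \<Phi> V)"
    if P: "lead_coeff P = 1 \<and> irreducible P" for P
  proof -
    have "P \<noteq> 0" using P by auto
    from main[OF this] show ?thesis
      using P irreducible_dvd_iff_roots_in_filled_lemniscate[of P V] by blast
  qed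
  fix \<alpha> :: complex
  assume \<alpha>: "algebraic_int \<alpha> \<and> \<alpha> \<in> filled_lemniscate V \<and> conjugates \<alpha> \<subseteq> filled_lemniscate V"
  then obtain P where P: "irreducible P" "lead_coeff P = 1" "poly (cpoly P) \<alpha> = 0"
    using irreducible_monic_int_poly_exists by blast
  \<comment> \<open>\<open>P\<close> is also the rational minimal polynomial of \<alpha>, so its
    roots are conjugates of \<alpha>.\<close>
  have "z \<in> filled_lemniscate V" if "poly (cpoly P) z = 0" for z
  proof -
    have "z \<in> conjugates \<alpha>"
      using irreducible_imp_is_min_poly[OF P] that unfolding conjugates_def
      by (auto intro!: exI[of _ "map_poly of_int P"] simp: of_rat_of_int_poly)
    then show ?thesis using \<alpha> by blast
  qed
  then have "P dvd V \<or> (\<exists>\<Phi>. cyclotomic \<Phi> \<and> P dvd pcompose \<Phi> V)"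
    using irreducible_dvd_iff_roots_in_filled_lemniscate[OF P(1,2)] by blast
  \<comment> \<open>In the first case \<open>V\<close> has modulus 0 at \<alpha>, in the second
    modulus 1. So a point of the interior excludes the second case, and a point of the lemniscate
    the first.\<close>
  then consider "poly (cpoly V) \<alpha> = 0"
    | \<Phi> where "cyclotomic \<Phi>" "poly (cpoly (pcompose \<Phi> V)) \<alpha> = 0"
    using dvd_imp_cpoly_root P(3) by blast
  note cases = this
  show "poly (cpoly V) \<alpha> = 0" if "\<alpha> \<in> interior (filled_lemniscate V)"
  proof (cases rule: cases)
    case (2 \<Phi>)
    then have "cmod (poly (cpoly V) \<alpha>) = 1"
      by (intro cyclotomic_root_of_unity[of \<Phi>]) (simp_all add: of_int_poly_pcompose poly_pcompose)
    with interior_filled_lemniscate[OF deg that] show ?thesis by simp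
  qed
  show "\<exists>\<Phi>. cyclotomic \<Phi> \<and> poly (cpoly (pcompose \<Phi> V)) \<alpha> = 0" if "\<alpha> \<in> lemniscate V"
    using that by (cases rule: cases) (auto simp: lemniscate_def)
qed

end
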